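(* Let $\Upsilon(z,t):=\sum_{k=0}^\infty q_k(z)\frac{t^k}{k!}$ be the exponential generating function of the polynomials $(q_k)$ defined in the context. Consider the algebraic curve $$2+3t+3t(1+t)\eta-2(1-3t^2+3t^4)\eta^3=0,$$ which is of genus $0$ and is parametrized by $$t=\frac13\,\frac{(w^2+3)w}{w^2+1},\qquad \eta=3\,\frac{(w+1)(w^2+1)}{w^4+3},$$ and let $\eta(t)$ be the branch that satisfies $\eta(0)=1$: $$\eta(t)=1+t+2\frac{t^2}{2!}+10\frac{t^3}{3!}+24\frac{t^4}{4!}+280\frac{t^5}{5!}+400\frac{t^6}{6!}+12880\frac{t^7}{7!}-\cdots.$$ Define $$\chi(t):=\sqrt{\eta(t)^2-\frac{2t(1+t)}{1-3t^2+3t^4}}=1+\frac{t^2}{2!}-2\frac{t^3}{3!}+\frac{t^4}{4!}-100\frac{t^5}{5!}-575\frac{t^6}{6!}-\cdots$$ and $$J(t):=\int_0^t\frac{du}{\sqrt{1-3u^2+3u^4}}=t+3\frac{t^3}{3!}+45\frac{t^5}{5!}+1215\frac{t^7}{7!}+8505\frac{t^9}{9!}-\cdots.$$ Then $$\Upsilon(z,t)=\eta(t)\cosh\left(zJ(t)\right)+\chi(t)\sinh\left(zJ(t)\right).$$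
   Context: Put $c_j=(-1)^{j-1}\left(j+\frac{1+(-1)^j}{2}\right)$ for $j\ge0$ and $a_j=-j^2(2-(-1)^j)$ for $j\ge1$. Let $Q_k(z)$ be the denominators of the convergents of the Jacobi continued fraction $\cfrac{1}{1-c_0z-\cfrac{a_1z^2}{1-c_1z-\cfrac{a_2z^2}{\ddots}}}$, that is, $Q_0=1$, $Q_1=1-c_0z$, and $Q_k=(1-c_{k-1}z)Q_{k-1}-a_{k-1}z^2Q_{k-2}$ for $k\ge2$. The reciprocal polynomials are $q_k(z)=z^kQ_k(1/z)$; equivalently $q_0=1$, $q_1=z-c_0=z+1$, and $q_k=(z-c_{k-1})q_{k-1}-a_{k-1}q_{k-2}$ for $k\ge2$. The final identity is between power series in $t$ with coefficients in $\mathbb{C}[z]$; the square roots are the branches equal to $1$ at $t=0$ (respectively $u=0$). *)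

theory Defs
  imports "HOL-Computational_Algebra.Computational_Algebra"
begin

definition c_coeff :: "nat \<Rightarrow> complex" where
  "c_coeff j = (-1) powi (int j - 1) * (of_nat j + (1 + (-1) ^ j) / 2)"

definition a_coeff :: "nat \<Rightarrow> complex" where
  "a_coeff j = - ((of_nat j)\<^sup>2) * (2 - (-1) ^ j)"

fun Q_poly :: "nat \<Rightarrow> complex poly" where
  "Q_poly 0 = 1"
| "Q_poly (Suc 0) = 1 - smult (c_coeff 0) [:0, 1:]"
| "Q_poly (Suc (Suc k)) =
     (1 - smult (c_coeff (Suc k)) [:0, 1:]) * Q_poly (Suc k)
     - smult (a_coeff (Suc k)) ([:0, 1:]\<^sup>2) * Q_poly k"

fun q_poly :: "nat \<Rightarrow> complex poly" where
  "q_poly 0 = 1"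
| "q_poly (Suc 0) = [:0, 1:] - [:c_coeff 0:]"
| "q_poly (Suc (Suc k)) =
     ([:0, 1:] - [:c_coeff (Suc k):]) * q_poly (Suc k)
     - smult (a_coeff (Suc k)) (q_poly k)"

lemma q_poly_reciprocal:
  assumes "z \<noteq> 0"
  shows "poly (q_poly k) z = z ^ k * poly (Q_poly k) (1 / z)"
  using assms
  by (induction k rule: Q_poly.induct) (simp_all add: field_simps power2_eq_square)

text \<open>Series in \<open>t\<close> over \<open>\<complex>[z]\<close> have type \<^typ>\<open>complex poly fps\<close>: the series variable is \<open>t\<close>,
  the polynomial variable is \<open>z\<close>.\<close>

definition Upsilon :: "complex poly fps" where
  "Upsilon = Abs_fps (\<lambda>k. smult (1 / fact k) (q_poly k))"

definition lift_z :: "complex fps \<Rightarrow> complex poly fps" where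
  "lift_z f = Abs_fps (\<lambda>n. [:f $ n:])"

definition fps_z :: "complex poly fps" where
  "fps_z = fps_const [:0, 1:]"

definition fps_cosh :: "complex fps" where
  "fps_cosh = fps_const (1/2) * (fps_exp 1 + fps_exp (-1))"

definition fps_sinh :: "complex fps" where
  "fps_sinh = fps_const (1/2) * (fps_exp 1 - fps_exp (-1))"

text \<open>The left-hand side of the equation of the curve. It is used at complex numbers, at formal
  power series, and at the two variables of \<open>\<complex>[t][\<eta>]\<close>.\<close>

definition curve :: "'a::comm_ring_1 \<Rightarrow> 'a \<Rightarrow> 'a" where
  "curve t y = 2 + 3 * t + 3 * t * (1 + t) * y - 2 * (1 - 3 * t^2 + 3 * t^4) * y^3"

definition curve_poly :: "complex poly poly" where
  "curve_poly = curve [:[:0, 1:]:] [:0, 1:]"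

definition is_branch :: "complex fps \<Rightarrow> bool" where
  "is_branch f \<longleftrightarrow> curve fps_X f = 0 \<and> f $ 0 = 1"

definition eta :: "complex fps" where
  "eta = (THE f. is_branch f)"

text \<open>For series with constant coefficient \<open>1\<close>: the square root with constant coefficient \<open>1\<close>.\<close>

definition fps_sqrt1 :: "complex fps \<Rightarrow> complex fps" where
  "fps_sqrt1 f = fps_radical (\<lambda>_ _. 1) 2 f"

definition chi :: "complex fps" where
  "chi = fps_sqrt1 (eta^2 - 2 * fps_X * (1 + fps_X) / (1 - 3 * fps_X^2 + 3 * fps_X^4))"

definition J_fps :: "complex fps" where
  "J_fps = fps_integral0 (1 / fps_sqrt1 (1 - 3 * fps_X^2 + 3 * fps_X^4))"

text \<open>The genus is the dimension of the space of regular differentials of the function field.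
  If \<open>P \<in> \<complex>[t][\<eta>]\<close> is irreducible of positive degree in \<open>\<eta>\<close> and the Laurent series \<open>y\<close> satisfies
  \<open>P(t, y) = 0\<close>, then \<open>(t, y)\<close> is a generic point of the curve \<open>P = 0\<close>, so that the function field
  of the curve is the field \<open>\<complex>(t, y)\<close> of Laurent series.\<close>

definition const_subalgebra :: "complex fls set \<Rightarrow> bool" where
  "const_subalgebra S \<longleftrightarrow>
     range fls_const \<subseteq> S \<and> (\<forall>x\<in>S. \<forall>y\<in>S. x + y \<in> S \<and> x * y \<in> S)"

definition function_field :: "complex fls \<Rightarrow> complex fls set" where
  "function_field y =
     \<Inter> {K. const_subalgebra K \<and> (\<forall>x\<in>K. inverse x \<in> K) \<and> fls_X \<in> K \<and> y \<in> K}"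

text \<open>Places are the valuation rings of \<open>L\<close> over \<open>\<complex>\<close>; in a function field of one variable these are
  discrete.\<close>

definition is_place :: "complex fls set \<Rightarrow> complex fls set \<Rightarrow> bool" where
  "is_place L V \<longleftrightarrow> const_subalgebra V \<and> V \<subset> L \<and> (\<forall>x\<in>L. x \<in> V \<or> inverse x \<in> V)"

definition is_uniformizer :: "complex fls set \<Rightarrow> complex fls \<Rightarrow> bool" where
  "is_uniformizer V p \<longleftrightarrow> p \<in> V \<and> {x\<in>V. x = 0 \<or> inverse x \<notin> V} = (\<lambda>x. p * x) ` V"

text \<open>The series \<open>f\<close> stands for the differential \<open>f dt\<close>, where \<open>t\<close> is the Laurent series variable.
  With a uniformizer \<open>p\<close> at a place, \<open>f dt = (f / p') dp\<close> for \<open>p' = dp/dt\<close>, so regularity at the place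
  means that \<open>f / p'\<close> lies in the valuation ring.\<close>

definition regular_differentials :: "complex fls set \<Rightarrow> complex fls set" where
  "regular_differentials L =
     {f\<in>L. \<forall>V p. is_place L V \<longrightarrow> is_uniformizer V p \<longrightarrow> f / fls_deriv p \<in> V}"

text \<open>An explicit finite basis is required because \<open>vector_space.dim\<close> is \<open>0\<close> on infinite-dimensional
  spaces.\<close>

definition has_genus :: "complex fls set \<Rightarrow> nat \<Rightarrow> bool" where
  "has_genus L g \<longleftrightarrow>
     (\<exists>B. finite B \<and> card B = g
        \<and> \<not> module.dependent (\<lambda>c f. fls_const c * f) B
        \<and> module.span (\<lambda>c f. fls_const c * f) B = regular_differentials L)"

end

theory Submission
  imports Defs "HOL-Computational_Algebra.Field_as_Ring"
begin

text \<open>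
  Everything is read off from the parameter \<open>w\<close>. Near \<open>t = 0\<close> the equation
  \<open>3 t (w\<^sup>2 + 1) = w\<^sup>3 + 3 w\<close> defines a power series \<open>w(t)\<close>, which is odd, and
  \<open>w' = 3 (w\<^sup>2 + 1)\<^sup>2 / (w\<^sup>4 + 3)\<close>. Write \<open>h = 3 (w\<^sup>2 + 1) / (w\<^sup>4 + 3)\<close>,
  \<open>D = 1 - 3 t\<^sup>2 + 3 t\<^sup>4\<close> and \<open>\<rho>\<^sup>2 = (w\<^sup>4 + 3 w\<^sup>2 + 3) / 3\<close>. The branch is \<open>\<eta> = h + w h\<close>, the
  relation \<open>D w'\<^sup>2 = \<rho>\<^sup>2\<close> gives \<open>J' = w' / \<rho>\<close>, and \<open>\<chi> = h / \<rho> - h w\<^sup>3 / (3 \<rho>)\<close>. Since \<open>w\<close> is odd,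
  each of these two sums is the decomposition into the even and the odd part.

  The generating function. The coefficients of the recurrence depend on the parity of the index, so
  it couples the even part \<open>e\<close> and the odd part \<open>o\<close> of \<open>\<Upsilon>\<close>. It is equivalent to the linear system
  \<open>(1 - t\<^sup>2) o' - t e' = (z + 1) e + t o\<close> and \<open>t o' + (1 - 3 t\<^sup>2) e' = z o + 3 t e\<close> with
  \<open>e(0) = 1\<close>, \<open>o(0) = 0\<close>: comparing coefficients determines \<open>e\<close> and \<open>o\<close>
  (\<open>Ups_even_rec\<close>, \<open>Ups_odd_rec\<close>, \<open>Ups_coeffs\<close>). The even and odd parts of
  \<open>\<eta> cosh (z J) + \<chi> sinh (z J)\<close> are
  \<open>h cosh (z J) - h w\<^sup>3 / (3 \<rho>) sinh (z J)\<close> and \<open>w h cosh (z J) + h / \<rho> sinh (z J)\<close>. Substituting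
  them and separating the terms with \<open>cosh\<close>, \<open>sinh\<close>, \<open>z cosh\<close> and \<open>z sinh\<close> leaves
  eight identities in \<open>w\<close>, \<open>\<rho>\<close> and their derivatives (\<open>series_system\<close>). Those with the factor \<open>z\<close> say
  that the matrix with rows \<open>(-t, 1 - t\<^sup>2)\<close> and \<open>(1 - 3 t\<^sup>2, t)\<close>, whose square is \<open>D\<close> times the identity, exchanges up to
  the factor \<open>\<surd>D\<close> the pair \<open>(h, w h)\<close> with the pair of the odd and the even part of \<open>\<chi>\<close>.

  The curve. For fixed \<open>t\<close> the left-hand side of its equation is, up to a constant, the product of
  \<open>(w\<^sup>4 + 3) \<eta> - 3 (w + 1) (w\<^sup>2 + 1)\<close> over the three roots \<open>w\<close> of
  \<open>w\<^sup>3 + 3 w = 3 t (w\<^sup>2 + 1)\<close>, so every affine point is parametrized (\<open>curve_points\<close>). A factor of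
  degree one in \<open>\<eta>\<close> is excluded because the leading coefficient \<open>-2 D\<close> is squarefree and prime to the
  constant coefficient (\<open>irreducible_curve_poly\<close>). Conversely \<open>w\<close> is a rational function of \<open>t\<close> and
  \<open>\<eta>\<close>, hence the function field is \<open>\<complex>(w)\<close>; a differential regular at all
  finite points is \<open>P(w) dw\<close> with a polynomial \<open>P\<close>, and regularity at infinity forces \<open>P = 0\<close>
  (\<open>genus_0\<close>).
\<close>

section \<open>Identities on the parametrized curve\<close>

text \<open>
  Here \<open>p\<close> stands for \<open>dw/dt\<close>. The first two identities evaluate the matrix with rows
  \<open>(-t, 1 - t\<^sup>2)\<close> and \<open>(1 - 3 t\<^sup>2, t)\<close> at the vector \<open>(1, w)\<close>, the next two evaluate it at the
  resulting vector, proportional to \<open>(-w\<^sup>3, 3)\<close>. The last one gives the value of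
  \<open>\<surd>(1 - 3 t\<^sup>2 + 3 t\<^sup>4)\<close>. The assumptions are cleared of denominators so that the lemmas of this
  section apply in domains of characteristic zero such as the ring of power series.
\<close>

lemma param_identities:
  fixes t w p :: "'a::{idom,semiring_char_0}"
  assumes T: "3 * t * (w^2+1) = w^3 + 3*w" and P: "p * (w^4+3) = 3 * (w^2+1)^2"
    and k: "w^4+3 \<noteq> 0"
  shows "p * (1 - 3*t^2 + t*w) = 1"
    and "3 * (p * ((1-t^2)*w - t)) = - (w^3)"
    and "p * (3 * (1-t^2) + t*w^3) = w^4+3*w^2+3"
    and "p * (3 * t - (1-3*t^2)*w^3) = w * (w^4+3*w^2+3)"
    and "3 * p^2 * (1-3*t^2+3*t^4) = w^4+3*w^2+3"
proof -
  have "(w^4+3) * (p * (1 - 3*t^2 + t*w) - 1) = 0" using T P by algebra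
  with k show "p * (1 - 3*t^2 + t*w) = 1" by simp
  have "(w^4+3) * (3 * (p * ((1-t^2)*w - t)) + w^3) = 0" using T P by algebra
  with k show "3 * (p * ((1-t^2)*w - t)) = - (w^3)" by (simp add: add_eq_0_iff2)
  have "(w^4+3) * (p * (3 * (1-t^2) + t*w^3) - (w^4+3*w^2+3)) = 0" using T P by algebra
  with k show "p * (3 * (1-t^2) + t*w^3) = w^4+3*w^2+3" by simp
  have "(w^4+3) * (p * (3 * t - (1-3*t^2)*w^3) - w * (w^4+3*w^2+3)) = 0" using T P by algebra
  with k show "p * (3 * t - (1-3*t^2)*w^3) = w * (w^4+3*w^2+3)" by simp
  have "(w^4+3)^2 * (3 * p^2 * (1-3*t^2+3*t^4) - (w^4+3*w^2+3)) = 0" using T P by algebra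
  with k show "3 * p^2 * (1-3*t^2+3*t^4) = w^4+3*w^2+3" by simp
qed

lemma curve_param:
  fixes t w y :: "'a::{idom,semiring_char_0}"
  assumes T: "3 * t * (w^2+1) = w^3 + 3*w" and Y: "y * (w^4+3) = 3 * (w+1) * (w^2+1)"
    and g: "w^2+1 \<noteq> 0" and k: "w^4+3 \<noteq> 0"
  shows "curve t y = 0"
proof -
  have D: "27 * (1-3*t^2+3*t^4) * (w^2+1)^4 = (w^4+3)^2 * (w^4+3*w^2+3)"
    using T by algebra
  have a: "(w^4+3) * (27 * (w^2+1)^4 * ((1-3*t^2+3*t^4) * y^3))
      = 27 * (w^4+3*w^2+3) * (w+1)^3 * (w^2+1)^3"
  proof -
    have "(w^4+3) * (27 * (w^2+1)^4 * ((1-3*t^2+3*t^4) * y^3)) = (w^4+3)^3 * y^3 * (w^4+3*w^2+3)"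
      using D by algebra
    also have "(w^4+3)^3 * y^3 = (3 * (w+1) * (w^2+1))^3" using Y by algebra
    finally show ?thesis by algebra
  qed
  have C: "(w^4+3) * (w^2+1) * ((1-3*t^2+3*t^4) * y^3) = (w^4+3*w^2+3) * (w+1)^3"
  proof -
    have "27 * ((w^2+1)^3 * ((w^4+3) * (w^2+1) * ((1-3*t^2+3*t^4) * y^3) - (w^4+3*w^2+3) * (w+1)^3)) = 0"
      using a by algebra
    with g show ?thesis by simp
  qed
  have "(w^4+3) * (w^2+1)^2 * curve t y = 0"
    unfolding curve_def using C T Y by algebra
  with g k show ?thesis by simp
qed

text \<open>
  The pair \<open>(h, w h)\<close> of the even and odd parts of \<open>\<eta>\<close> solves the system of the generating function
  at \<open>z = 0\<close>; \<open>h1\<close> is the derivative of \<open>h\<close>, given by differentiating the equation for \<open>h\<close>.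
\<close>

lemma eta_parts_system:
  fixes t w p h h1 :: "'a::{idom,semiring_char_0}"
  assumes T: "3 * t * (w^2+1) = w^3 + 3*w" and P: "p * (w^4+3) = 3 * (w^2+1)^2"
    and k: "w^4+3 \<noteq> 0"
    and H: "h * (w^4+3) = 3 * (w^2+1)"
    and H1: "h1 * (w^4+3) + 4*h*w^3*p = 6*w*p"
  shows "(1 - t^2) * (p*h + w*h1) - t*h1 = h + t*(w*h)"
    and "t * (p*h + w*h1) + (1-3*t^2)*h1 = 3*t*h"
proof -
  have "(w^4+3)^2*((1 - t^2) * (p*h + w*h1) - t*h1 - (h + t*(w*h))) = 0"
    using T P H H1 by algebra
  with k show "(1 - t^2) * (p*h + w*h1) - t*h1 = h + t*(w*h)" by simp
  have "(w^4+3)^2*(t * (p*h + w*h1) + (1-3*t^2)*h1 - 3*t*h) = 0"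
    using T P H H1 by algebra
  with k show "t * (p*h + w*h1) + (1-3*t^2)*h1 = 3*t*h" by simp
qed

text \<open>
  The same for the parts of \<open>\<chi>\<close>: \<open>y = h / \<rho>\<close> is the even and \<open>x = - y w\<^sup>3 / 3\<close> the odd one, and
  \<open>y1\<close>, \<open>x1\<close> are their derivatives. In the system \<open>x\<close> takes the even and \<open>y\<close> the odd slot, because
  both are multiplied by the odd function \<open>sinh (z J)\<close>. The assumption on \<open>y1\<close> gives the logarithmic
  derivative \<open>y1 / y\<close> in terms of \<open>w\<close> and \<open>p = w'\<close>.
\<close>

lemma chi_parts_system:
  fixes t w p y y1 :: "'a::{idom,semiring_char_0}"
  assumes T: "3 * t * (w^2+1) = w^3 + 3*w" and P: "p * (w^4+3) = 3 * (w^2+1)^2"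
    and g: "w^2+1 \<noteq> 0" and k: "w^4+3 \<noteq> 0"
    and Y: "y1 * ((w^2+1)*(w^4+3)*(w^4+3*w^2+3)) =
       - y * p * w * (2*(w^2+3)*(w^2-1)*(w^4+3*w^2+3) + (2*w^2+3)*(w^2+1)*(w^4+3))"
    and x: "3 * x = - y*w^3" and x1: "3*x1 = - (y1*w^3 + 3*y*w^2*p)"
  shows "(1 - t^2) * y1 - t*x1 = x + t*y"
    and "t * y1 + (1-3*t^2)*x1 = 3*t*x"
proof -
  note K = param_identities(3,4)[OF T P k]
  have p: "p \<noteq> 0" using P g by auto
  have a: "(w^2+1)*(w^4+3)*(3*t - w^3 - 3*t*w^2*p) =
    - w * (2*(w^2+3)*(w^2-1)*(w^4+3*w^2+3) + (2*w^2+3)*(w^2+1)*(w^4+3))"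
    using T P by algebra
  \<comment> \<open>The factor \<open>p\<close> turns the coefficient of \<open>y1\<close> into \<open>w\<^sup>4 + 3 w\<^sup>2 + 3\<close>, by \<open>param_identities\<close>.\<close>
  have "((w^2+1)*(w^4+3)) * (p * (3*((1 - t^2) * y1 - t*x1 - (x + t*y))))
     = ((w^2+1)*(w^4+3)) * (y1 * (p * (3 * (1-t^2) + t*w^3)) - p * y * (3*t - w^3 - 3*t*w^2*p))"
    using x x1 by algebra
  also have "\<dots> = 0" unfolding K using Y a by algebra
  finally show "(1 - t^2) * y1 - t*x1 = x + t*y"
    using g k p by (simp del: right_diff_distrib_numeral)
  have b: "(w^2+1)*(w^4+3)*(3*w^2*p*(1-3*t^2) - 3*t*w^3) =
    - (w^2) * (2*(w^2+3)*(w^2-1)*(w^4+3*w^2+3) + (2*w^2+3)*(w^2+1)*(w^4+3))"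
  proof -
    have "(w^2+1)*((w^2+1)*(w^4+3)*(3*w^2*p*(1-3*t^2) - 3*t*w^3) +
     w^2 * (2*(w^2+3)*(w^2-1)*(w^4+3*w^2+3) + (2*w^2+3)*(w^2+1)*(w^4+3))) = 0"
    using T P by algebra
    with g show ?thesis by (simp add: add_eq_0_iff2)
  qed
  have "((w^2+1)*(w^4+3)) * (p * (3*(t * y1 + (1-3*t^2)*x1 - 3*t*x)))
     = ((w^2+1)*(w^4+3)) * (y1 * (p * (3 * t - (1-3*t^2)*w^3)) - p * y * (3*w^2*p*(1-3*t^2) - 3*t*w^3))"
    using x x1 by algebra
  also have "\<dots> = 0" unfolding K using Y b by algebra
  finally show "t * y1 + (1-3*t^2)*x1 = 3*t*x"
    using g k p by (simp del: right_diff_distrib_numeral)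
qed

text \<open>
  Multiplied by \<open>9 p\<^sup>2\<close>, the claim becomes \<open>h\<^sup>2\<close> times an identity in \<open>w\<close> alone, because
  \<open>3 p\<^sup>2 (1 - 3 t\<^sup>2 + 3 t\<^sup>4) = w\<^sup>4 + 3 w\<^sup>2 + 3\<close> and \<open>h (w\<^sup>2 + 1) = p\<close>.
\<close>

lemma chi_square:
  fixes t w p h r c :: "'a::{idom,semiring_char_0}"
  assumes T: "3 * t * (w^2+1) = w^3 + 3*w" and P: "p * (w^4+3) = 3 * (w^2+1)^2"
    and g: "w^2+1 \<noteq> 0" and k: "w^4+3 \<noteq> 0"
    and H: "h * (w^4+3) = 3 * (w^2+1)"
    and R: "r^2 * (w^4+3*w^2+3) = 3"
    and C: "3 * c = h * r * (3 - w^3)"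
  shows "(1-3*t^2+3*t^4) * c^2 = (1-3*t^2+3*t^4) * (h*(1+w))^2 - 2*t*(1+t)"
proof -
  note D = param_identities(5)[OF T P k]
  have hg: "h * (w^2+1) = p"
  proof -
    have "(w^4+3) * (h * (w^2+1) - p) = 0" using P H by algebra
    with k show ?thesis by simp
  qed
  have 1: "3 * p^2 * c^2 * (1-3*t^2+3*t^4) * 3 = h^2 * (3-w^3)^2"
    unfolding D using C R D by algebra
  have 2: "h^2*(3-w^3)^2 = 3 * h^2 * (1+w)^2 * (w^4+3*w^2+3) - 18 * p^2 * t*(1+t)"
  proof -
    have "(3-w^3)^2 = 3*(1+w)^2*(w^4+3*w^2+3) - 2*(w^3+3*w)*((3*(w^2+1)+w^3+3*w))"
      by algebra
    with T hg show ?thesis by algebra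
  qed
  have "9 * p^2 * ((1-3*t^2+3*t^4) * c^2 - ((1-3*t^2+3*t^4) * (h*(1+w))^2 - 2*t*(1+t))) = 0"
    using 1 2 D by algebra
  moreover have "p \<noteq> 0" using P g by auto
  ultimately show ?thesis by simp
qed

text \<open>
  The remainder of \<open>(w\<^sup>4 + 3) y - 3 (w + 1) (w\<^sup>2 + 1)\<close> on division by the cubic
  \<open>w\<^sup>3 - 3 t w\<^sup>2 + 3 w - 3 t\<close>, as a quadratic polynomial in \<open>w\<close>.
\<close>

definition quad2 :: "'a::comm_ring_1 \<Rightarrow> 'a \<Rightarrow> 'a" where "quad2 t y = y * (9 * t^2 - 3) - 3 * (3 * t + 1)"
definition quad1 :: "'a::comm_ring_1 \<Rightarrow> 'a \<Rightarrow> 'a" where "quad1 t y = 6 - 6 * t * y"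
definition quad0 :: "'a::comm_ring_1 \<Rightarrow> 'a \<Rightarrow> 'a" where "quad0 t y = y * (9 * t^2 + 3) - 3 * (3 * t + 1)"

lemma param_quadratic:
  fixes t y w :: "'a::idom"
  assumes "3 * t * (w^2+1) = w^3 + 3*w"
  shows "y * (w^4+3) - 3 * (w+1) * (w^2+1) = quad2 t y * w^2 + quad1 t y * w + quad0 t y"
  using assms unfolding quad2_def quad1_def quad0_def by algebra

text \<open>
  A further step of the Euclidean algorithm, without division: for a common root \<open>w\<close> of the cubic
  and the quadratic remainder it leaves the linear equation \<open>w param_den = param_num\<close>.
\<close>

definition param_den :: "'a::comm_ring_1 \<Rightarrow> 'a \<Rightarrow> 'a" where
  "param_den t y = quad2 t y * (3 * quad2 t y - quad0 t y) + (3 * t * quad2 t y + quad1 t y) * quad1 t y"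
definition param_num :: "'a::comm_ring_1 \<Rightarrow> 'a \<Rightarrow> 'a" where
  "param_num t y = 3 * t * (quad2 t y)^2 - (3 * t * quad2 t y + quad1 t y) * quad0 t y"

lemma param_rational:
  fixes t y w :: "'a::idom"
  assumes "3 * t * (w^2+1) = w^3 + 3*w" "y * (w^4+3) = 3 * (w+1) * (w^2+1)"
  shows "w * param_den t y = param_num t y"
proof -
  have "quad2 t y * w^2 + quad1 t y * w + quad0 t y = 0"
    using param_quadratic[OF assms(1), of y] assms(2) by simp
  with assms(1) show ?thesis unfolding param_den_def param_num_def by algebra
qed

section \<open>The affine points of the curve\<close>

lemma cubic_roots:
  fixes t :: complex
  obtains w1 w2 w3 where "w1 + w2 + w3 = 3 * t" "w1 * w2 + w1 * w3 + w2 * w3 = 3" "w1 * w2 * w3 = 3 * t"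
proof -
  have "\<exists>x. poly [:-3*t, 3, -3*t, 1:] x = 0" by (rule alg_closed_imp_poly_has_root) simp
  then obtain w1 where 1: "w1^3 + 3 * w1 = 3 * t * (w1^2 + 1)"
    by (auto simp: algebra_simps power2_eq_square power3_eq_cube)
  have "\<exists>x. poly [:w1^2 - 3*t*w1 + 3, w1 - 3*t, 1:] x = 0" by (rule alg_closed_imp_poly_has_root) simp
  then obtain w2 where 2: "w2^2 + (w1 - 3*t) * w2 + (w1^2 - 3*t*w1 + 3) = 0"
    by (auto simp: algebra_simps power2_eq_square)
  define w3 where "w3 = 3*t - w1 - w2"
  have "w1 + w2 + w3 = 3 * t" by (simp add: w3_def)
  moreover have "w1 * w2 + w1 * w3 + w2 * w3 = 3" using 2 unfolding w3_def by algebra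
  moreover have "w1 * w2 * w3 = 3 * t" using 1 2 unfolding w3_def by algebra
  ultimately show ?thesis by (rule that)
qed

text \<open>The resultant of a monic cubic with the roots \<open>x1\<close>, \<open>x2\<close>, \<open>x3\<close> and a quadratic polynomial.\<close>

lemma cubic_norm:
  fixes A B C x1 x2 x3 :: "'a::idom"
  assumes "x1 + x2 + x3 = e1" "x1 * x2 + x1 * x3 + x2 * x3 = e2" "x1 * x2 * x3 = e3"
  shows "(A * x1^2 + B * x1 + C) * (A * x2^2 + B * x2 + C) * (A * x3^2 + B * x3 + C) =
    C^3 + C^2*B*e1 + C^2*A*(e1^2 - 2*e2) + C*B^2*e2 + C*A*B*(e1*e2 - 3*e3) + C*A^2*(e2^2 - 2*e1*e3)
    + B^3*e3 + B^2*A*e1*e3 + B*A^2*e2*e3 + A^3*e3^2"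
  unfolding assms[symmetric] by algebra

text \<open>
  For a point \<open>(t, y)\<close> of the curve, the product of the values of the quadratic remainder at the
  three roots of the cubic vanishes, so one of the roots is a parameter of the point. At such a
  root the denominators cannot vanish: \<open>w\<^sup>2 = -1\<close> would make the cubic equal to \<open>2 w\<close>, and
  \<open>w\<^sup>4 = -3\<close> would require \<open>(w + 1) (w\<^sup>2 + 1) = 0\<close>.
\<close>

lemma curve_points:
  "{(t :: complex, y :: complex). curve t y = 0} =
        (\<lambda>w. (1/3 * ((w^2 + 3) * w / (w^2 + 1)),
              3 * ((w + 1) * (w^2 + 1) / (w^4 + 3)))) ` {w. w^2 + 1 \<noteq> 0 \<and> w^4 + 3 \<noteq> 0}"
  (is "?L = ?f ` ?S")
proof (intro equalityI subsetI)
  fix z assume "z \<in> ?f ` ?S"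
  then obtain w where w: "w^2 + 1 \<noteq> 0" "w^4 + 3 \<noteq> 0" "z = ?f w" by blast
  have *: "3 * (1/3 * v) * u = v * u" and **: "u \<noteq> 0 \<Longrightarrow> v / u * u = v" for u v :: complex by simp_all
  from * have "3 * (1/3 * ((w^2 + 3) * w / (w^2 + 1))) * (w^2 + 1) = (w^2 + 3) * w / (w^2 + 1) * (w^2 + 1)" .
  also have "\<dots> = (w^2 + 3) * w" using w(1) by (rule **)
  also have "\<dots> = w^3 + 3 * w" by algebra
  finally have T: "3 * (1/3 * ((w^2 + 3) * w / (w^2 + 1))) * (w^2 + 1) = w^3 + 3 * w" .
  have Y: "3 * ((w + 1) * (w^2 + 1) / (w^4 + 3)) * (w^4 + 3) = 3 * (w + 1) * (w^2 + 1)"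
    using w(2) by simp
  have "curve (1/3 * ((w^2 + 3) * w / (w^2 + 1))) (3 * ((w + 1) * (w^2 + 1) / (w^4 + 3))) = 0"
    by (rule curve_param[OF T Y w(1,2)])
  then show "z \<in> ?L" by (simp add: w(3))
next
  fix z assume "z \<in> ?L"
  then obtain t y where z: "z = (t, y)" and c: "curve t y = 0" by blast
  obtain w1 w2 w3 where w: "w1 + w2 + w3 = 3 * t" "w1 * w2 + w1 * w3 + w2 * w3 = 3" "w1 * w2 * w3 = 3 * t"
    by (rule cubic_roots)
  define q where "q x = quad2 t y * x^2 + quad1 t y * x + quad0 t y" for x
  \<comment> \<open>The constant is found at \<open>t = 0\<close>: there the roots are \<open>0\<close> and \<open>\<plusminus>i\<surd>3\<close>, the product of the values of
    \<open>w\<^sup>4 + 3\<close> is \<open>3 \<cdot> 12 \<cdot> 12 = 432\<close>, and \<open>curve\<close> has the leading coefficient \<open>-2\<close>.\<close>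
  have "q w1 * q w2 * q w3 = - 216 * curve t y"
    unfolding q_def cubic_norm[OF w] quad2_def quad1_def quad0_def curve_def by algebra
  with c obtain w where w: "w = w1 \<or> w = w2 \<or> w = w3" and q: "q w = 0" by auto
  have T: "3 * t * (w^2+1) = w^3 + 3*w"
    using w \<open>w1 + w2 + w3 = 3 * t\<close> \<open>w1 * w2 + w1 * w3 + w2 * w3 = 3\<close> \<open>w1 * w2 * w3 = 3 * t\<close>
    by (elim disjE) (simp_all only:, algebra+)
  have Y: "y * (w^4+3) = 3 * (w+1) * (w^2+1)"
    using param_quadratic[OF T, of y] q unfolding q_def by simp
  have g: "w^2+1 \<noteq> 0"
  proof
    assume g: "w^2+1 = 0"
    with T have "w * 2 = 0" by algebra
    with g show False by simp
  qed
  have k: "w^4+3 \<noteq> 0"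
  proof
    assume k: "w^4+3 = 0"
    with Y g have "w = -1" by (simp add: add_eq_0_iff2)
    with k show False by simp
  qed
  have "(w^2 + 3) * w = 3 * t * (w^2 + 1)" using T by algebra
  then have "(w^2 + 3) * w / (w^2 + 1) = 3 * t" by (rule nonzero_divide_eq_eq[OF g, THEN iffD2])
  then have "t = 1/3 * ((w^2 + 3) * w / (w^2 + 1))" by simp
  moreover have "y / 3 * (w^4 + 3) = (w + 1) * (w^2 + 1)" using Y by simp
  then have "y / 3 = (w + 1) * (w^2 + 1) / (w^4 + 3)" by (rule nonzero_eq_divide_eq[OF k, THEN iffD2])
  then have "y = 3 * ((w + 1) * (w^2 + 1) / (w^4 + 3))"
    by (metis nonzero_mult_div_cancel_left times_divide_eq_right zero_neq_numeral)
  ultimately have "z = ?f w" by (simp add: z)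
  with g k show "z \<in> ?f ` ?S" by blast
qed

section \<open>Irreducibility\<close>

lemma curve_poly_coeffs:
  "curve_poly = [:[:2, 3:], [:0, 3, 3:], 0, [:-2, 0, 6, 0, -6:]:]"
  by (simp add: curve_poly_def curve_def eval_nat_numeral numeral_poly one_pCons)

text \<open>
  A root \<open>r\<close> of \<open>a\<close> would be a double root of \<open>1 - 3 t\<^sup>2 + 3 t\<^sup>4\<close>, but this polynomial and its
  derivative have no common root.
\<close>

lemma leading_coeff_squarefree:
  fixes a :: "complex poly"
  assumes "a * a dvd [:-2, 0, 6, 0, -6:]"
  shows "degree a = 0"
proof (rule ccontr)
  assume "degree a \<noteq> 0"
  then obtain r where r: "poly a r = 0" using alg_closed_imp_poly_has_root[of a] by auto
  from assms obtain s where s: "[:-2, 0, 6, 0, -6:] = a * a * s" by blast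
  have 1: "6 * r^2 - 6 * r^4 - 2 = 0"
    using arg_cong[OF s, of "\<lambda>p. poly p r"] r by (simp add: algebra_simps eval_nat_numeral)
  have "pderiv [:-2, 0, 6, 0, -6:] = pderiv (a * a * s)" by (simp only: s)
  from arg_cong[OF this, of "\<lambda>p. poly p r"] have "12 * r - 24 * r^3 = 0"
    using r by (simp add: pderiv_mult pderiv_pCons algebra_simps eval_nat_numeral)
  with 1 show False by algebra
qed

text \<open>
  In \<open>(a \<eta> + b) (c \<eta>\<^sup>2 + d \<eta> + e)\<close> the missing quadratic term gives \<open>a d = - b c\<close>, and \<open>a\<close> is prime
  to \<open>b\<close> because \<open>-2 (1 - 3 t\<^sup>2 + 3 t\<^sup>4)\<close> is prime to \<open>2 + 3 t\<close>. Thus \<open>a\<close> divides \<open>c\<close>, its square divides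
  the leading coefficient, and \<open>a\<close> is constant. Then \<open>c\<close> and hence \<open>b d\<close> have degree at least
  4, which is too large for the coefficient \<open>3 t + 3 t\<^sup>2\<close> of \<open>\<eta>\<close>.
\<close>

lemma no_linear_factor:
  assumes "curve_poly = A * B" "degree A = 1"
  shows False
proof -
  obtain a b where A: "A = [:b, a:]" and a: "a \<noteq> 0"
    using assms(2) by (metis One_nat_def degree_eq_zeroE degree_pCons_eq_if nat.simps(3) pCons_cases old.nat.inject pCons_0_0)
  have "curve_poly \<noteq> 0" by (simp add: curve_poly_coeffs)
  then have "A \<noteq> 0" "B \<noteq> 0" using assms(1) by auto
  then have "degree curve_poly = degree A + degree B" unfolding assms(1) by (rule degree_mult_eq)
  then have dB: "degree B = 2" using assms(2) by (simp add: curve_poly_coeffs)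
  define e d c where "e = coeff B 0" and "d = coeff B 1" and "c = coeff B 2"
  have B: "B = [:e, d, c:]"
    by (rule poly_eqI) (use dB in \<open>auto simp: e_def d_def c_def coeff_pCons numeral_2_eq_2 coeff_eq_0 split: nat.split\<close>)
  have eqs: "b * e = [:2, 3:]" "a * e + b * d = [:0, 3, 3:]" "a * d + b * c = 0" "a * c = [:-2, 0, 6, 0, -6:]"
    using assms(1) unfolding A B curve_poly_coeffs by (simp_all add: mult.commute add.commute)
  have "coprime [:2, 3 :: complex:] [:-2, 0, 6, 0, -6:]"
  proof (rule coprimeI)
    fix u assume u: "u dvd [:2, 3 :: complex:]" "u dvd [:-2, 0, 6, 0, -6:]"
    \<comment> \<open>A Bezout combination with value \<open>7\<close>, from dividing the quartic by \<open>2 + 3 t\<close>.\<close>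
    have "u dvd [:2, 3:] * [:-10, 15, 18, -27:] + [:-2, 0, 6, 0, -6:] * [:-27/2:]"
      using u by (intro dvd_add dvd_mult2)
    then have "u dvd [:7:]" by simp
    then show "is_unit u" by (rule dvd_trans) (simp add: is_unit_const_poly_iff dvd_field_iff)
  qed
  then have "coprime (b * e) (a * c)" by (simp only: eqs)
  then have cop: "coprime a b" by (simp add: coprime_commute[of a b])
  have "a * d = - (b * c)" using eqs(3) by (simp add: add_eq_0_iff2)
  then have "a dvd b * c" by (metis dvd_minus_iff dvd_triv_left)
  with cop have "a dvd c" by (simp add: coprime_dvd_mult_right_iff)
  then have "a * a dvd [:-2, 0, 6, 0, -6:]" unfolding eqs(4)[symmetric] by simp
  then have da: "degree a = 0" by (rule leading_coeff_squarefree)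
  have nz: "b \<noteq> 0" "e \<noteq> 0" "c \<noteq> 0" using eqs(1,4) by auto
  have "degree a + degree c = 4" using arg_cong[OF eqs(4), of degree] a nz by (simp add: degree_mult_eq)
  moreover have "degree b + degree e = 1" using arg_cong[OF eqs(1), of degree] nz by (simp add: degree_mult_eq)
  moreover have "d \<noteq> 0" using eqs(3) nz by auto
  moreover have "degree a + degree d = degree b + degree c"
    using arg_cong[OF \<open>a * d = - (b * c)\<close>, of degree] a nz \<open>d \<noteq> 0\<close> by (simp add: degree_mult_eq)
  ultimately have "degree (a * e) < degree (b * d)" "degree (b * d) \<ge> 4"
    using a nz da by (simp_all add: degree_mult_eq)
  then have "degree (a * e + b * d) \<ge> 4" by (simp add: degree_add_eq_right)
  then show False unfolding eqs(2) by simp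
qed

lemma constant_factor_is_unit:
  assumes "curve_poly = A * B" "degree A = 0"
  shows "is_unit A"
proof -
  obtain a where A: "A = [:a:]" using assms(2) by (rule degree_eq_zeroE)
  have "a dvd coeff curve_poly n" for n unfolding assms(1) by (simp add: A)
  from this[of 0] this[of 1] have u: "a dvd [:2, 3:]" "a dvd [:0, 3, 3:]" by (simp_all add: curve_poly_coeffs)
  \<comment> \<open>The division leaves the constant remainder \<open>-2/3\<close>.\<close>
  then have "a dvd [:0, 3, 3:] - [:2, 3:] * [:1/3, 1:]" by (intro dvd_diff dvd_mult2)
  then have "a dvd [:-2/3:]" by simp
  then have "is_unit a" by (rule dvd_trans) (simp add: is_unit_const_poly_iff dvd_field_iff)
  then show ?thesis by (simp add: A is_unit_const_poly_iff)
qed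

lemma irreducible_curve_poly: "irreducible curve_poly"
proof (rule irreducibleI)
  show nz: "curve_poly \<noteq> 0" by (simp add: curve_poly_coeffs)
  show "\<not> is_unit curve_poly" by (auto simp: curve_poly_coeffs dest: is_unit_poly_iff[THEN iffD1])
  fix A B assume AB: "curve_poly = A * B"
  have "A \<noteq> 0" "B \<noteq> 0" using AB nz by auto
  then have "degree curve_poly = degree A + degree B" unfolding AB by (rule degree_mult_eq)
  then have "degree A + degree B = 3" by (simp add: curve_poly_coeffs)
  moreover have "degree A \<noteq> 1" "degree B \<noteq> 1"
    using no_linear_factor[OF AB] no_linear_factor[of B A] AB by (auto simp: mult.commute)
  ultimately have "degree A = 0 \<or> degree B = 0" by linarith
  then show "is_unit A \<or> is_unit B"
    using constant_factor_is_unit[OF AB] constant_factor_is_unit[of B A] AB by (auto simp: mult.commute)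
qed

section \<open>The branch through the point (0, 1)\<close>

lemma fps_sqrt1_unique:
  assumes "f $ 0 = 1" "g^2 = f" "g $ 0 = 1"
  shows "fps_sqrt1 f = g"
  using radical_unique[of "\<lambda>_ _. 1" 1 f g] assms
  by (simp add: fps_sqrt1_def numeral_2_eq_2)

lemma fps_sqrt1_square:
  assumes "f $ 0 = 1"
  shows "(fps_sqrt1 f)^2 = f" "fps_sqrt1 f $ 0 = 1"
  using power_radical[of f "\<lambda>_ _. 1" 1] assms
  by (simp_all add: fps_sqrt1_def numeral_2_eq_2)

text \<open>
  The parameter \<open>w\<close> as a function of \<open>t\<close>: the compositional inverse of \<open>(w\<^sup>3 + 3 w) / (3 (w\<^sup>2 + 1))\<close>.
\<close>

definition wt :: "complex fps" where
  "wt = fps_inv ((fps_X^3 + 3 * fps_X) * inverse (3 * (fps_X^2 + 1)))"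

lemma wt_0 [simp]: "wt $ 0 = 0"
  by (simp add: wt_def fps_inv_def)

lemma wt_eq: "3 * fps_X * (wt^2 + 1) = wt^3 + 3 * wt"
proof -
  define T :: "complex fps" where "T = (fps_X^3 + 3 * fps_X) * inverse (3 * (fps_X^2 + 1))"
  have T0: "T $ 0 = 0" by (simp add: T_def)
  have TX: "T * (3 * (fps_X^2 + 1)) = fps_X^3 + 3 * fps_X"
    unfolding T_def mult.assoc by (subst inverse_mult_eq_1) auto
  have "(T * (3 * (fps_X^2 + 1))) $ 1 = 3" unfolding TX by simp
  then have T1: "T $ 1 \<noteq> 0" by (auto simp: fps_mult_nth T0)
  have "T oo wt = fps_X" unfolding wt_def T_def[symmetric] by (rule fps_inv_right[OF T0 T1])
  moreover have "(T * (3 * (fps_X^2 + 1))) oo wt = (fps_X^3 + 3 * fps_X) oo wt"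
    by (simp only: TX)
  ultimately show ?thesis
    by (simp add: fps_compose_mult_distrib fps_compose_add_distrib fps_compose_power[symmetric] mult.assoc
      numeral_fps_const mult.commute mult.left_commute)
qed

lemma wt_units [simp]: "wt^2 + 1 \<noteq> 0" "wt^4 + 3 \<noteq> 0" "wt^4 + 3*wt^2 + 3 \<noteq> 0"
proof -
  have "(wt^2 + 1) $ 0 \<noteq> 0" "(wt^4 + 3) $ 0 \<noteq> 0" "(wt^4 + 3*wt^2 + 3) $ 0 \<noteq> 0"
    by (simp_all add: fps_power_zeroth)
  then show "wt^2 + 1 \<noteq> 0" "wt^4 + 3 \<noteq> 0" "wt^4 + 3*wt^2 + 3 \<noteq> 0"
    by (metis fps_zero_nth)+
qed

lemma wt_deriv: "fps_deriv wt * (wt^4 + 3) = 3 * (wt^2 + 1)^2"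
proof -
  have "fps_deriv (3 * fps_X * (wt^2 + 1)) = fps_deriv (wt^3 + 3 * wt)" by (simp only: wt_eq)
  then have "3 * (wt^2+1) + 3 * fps_X * (2 * wt * fps_deriv wt) = 3 * wt^2 * fps_deriv wt + 3 * fps_deriv wt"
    by (simp add: power2_eq_square power3_eq_cube algebra_simps)
  then show ?thesis using wt_eq by algebra
qed

text \<open>
  The even part \<open>h\<close> of \<open>\<eta>\<close>, the odd part being \<open>w h\<close>, and \<open>1 / \<rho>\<close> for
  \<open>\<rho>\<^sup>2 = (w\<^sup>4 + 3 w\<^sup>2 + 3) / 3\<close>.
\<close>

definition eta_even :: "complex fps" where "eta_even = 3 * (wt^2 + 1) * inverse (wt^4 + 3)"
definition rho_inv :: "complex fps" where "rho_inv = fps_sqrt1 (3 * inverse (wt^4 + 3 * wt^2 + 3))"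

lemma eta_even_eq: "eta_even * (wt^4 + 3) = 3 * (wt^2 + 1)"
  unfolding eta_even_def mult.assoc by (subst inverse_mult_eq_1) (auto simp: fps_power_zeroth)

lemma rho_inv_eq: "rho_inv^2 * (wt^4 + 3 * wt^2 + 3) = 3" and rho_inv_0 [simp]: "rho_inv $ 0 = 1"
proof -
  have *: "(3 * inverse (wt^4 + 3 * wt^2 + 3)) $ 0 = 1" by (simp add: fps_power_zeroth)
  note ** = fps_sqrt1_square[OF *, folded rho_inv_def]
  show "rho_inv $ 0 = 1" by fact
  show "rho_inv^2 * (wt^4 + 3 * wt^2 + 3) = 3"
    unfolding ** mult.assoc by (subst inverse_mult_eq_1) (auto simp: fps_power_zeroth)
qed

lemma eta_even_0 [simp]: "eta_even $ 0 = 1"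
  by (simp add: eta_even_def fps_power_zeroth)

lemma wt_1 [simp]: "wt $ Suc 0 = 1"
  using arg_cong[OF wt_deriv, of "\<lambda>f. f $ 0"] by (simp add: fps_power_zeroth)

lemma is_branch_param: "is_branch (eta_even * (1 + wt))"
  unfolding is_branch_def
proof
  have "(eta_even * (1 + wt)) * (wt^4+3) = 3 * (wt+1) * (wt^2+1)" using eta_even_eq by algebra
  then show "curve fps_X (eta_even * (1 + wt)) = 0" by (intro curve_param[of _ wt] wt_eq wt_units)
qed simp

text \<open>
  Uniqueness of Hensel lifting: the difference of the values of \<open>curve\<close> at \<open>f\<close> and \<open>g\<close> is \<open>f - g\<close>
  times a series whose constant coefficient \<open>-6\<close> is invertible. With \<open>e = 0\<close> this is uniqueness of the
  branch. With \<open>n > 0\<close> it bounds the error of a polynomial approximation, the constant \<open>c\<close>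
  clearing its denominators.
\<close>

lemma branch_agree:
  assumes "is_branch f" "g $ 0 = 1" "c * curve fps_X g = fps_X ^ n * e" "c $ 0 \<noteq> 0"
  shows "\<exists>d. f = g + fps_X ^ n * (e * d)"
proof -
  define s where "s = c * (2 * (1 - 3*fps_X^2 + 3*fps_X^4) * (f^2 + f*g + g^2) - 3*fps_X*(1+fps_X))"
  have f: "curve fps_X f = 0" "f $ 0 = 1" using assms by (auto simp: is_branch_def)
  have s0: "s $ 0 \<noteq> 0" using f assms by (simp add: s_def fps_power_zeroth)
  have "(f - g) * s = fps_X ^ n * e"
  proof -
    have "(f - g) * s = E" if "c * curve fps_X g = E" for E
      unfolding s_def using f(1) that unfolding curve_def by algebra
    then show ?thesis using assms(3) by blast
  qed
  then have "(f - g) * (s * inverse s) = fps_X ^ n * (e * inverse s)"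
    by (simp add: mult.assoc[symmetric])
  then have "f = g + fps_X ^ n * (e * inverse s)" using s0 by (simp add: inverse_mult_eq_1' algebra_simps)
  then show ?thesis ..
qed

lemma ex1_branch: "\<exists>!f. is_branch f"
proof (rule ex1I, rule is_branch_param)
  fix f assume "is_branch f"
  from branch_agree[OF this, of "eta_even * (1 + wt)" 1 0 0] show "f = eta_even * (1 + wt)"
    using is_branch_param by (auto simp: is_branch_def)
qed

lemma eta_is_branch: "is_branch eta"
  unfolding eta_def by (rule theI'[OF ex1_branch])

lemma eta_param: "eta = eta_even * (1 + wt)"
  using ex1_branch eta_is_branch is_branch_param by blast

lemma fps_div_unit_eq:
  fixes f g h :: "complex fps"
  assumes "g $ 0 \<noteq> 0" "h * g = f"
  shows "f / g = h"
  unfolding assms(2)[symmetric] using assms(1) by (simp add: fps_divide_unit mult.assoc inverse_mult_eq_1')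

section \<open>The square roots along the branch\<close>

text \<open>The even and odd parts of \<open>\<chi>\<close>; their sum is \<open>\<chi>\<close> by \<open>chi_split\<close>.\<close>

definition chi_even :: "complex fps" where "chi_even = eta_even * rho_inv"
definition chi_odd :: "complex fps" where "chi_odd = - (fps_const (1/3) * chi_even * wt^3)"

lemma chi_odd_eq: "3 * chi_odd = - chi_even * wt^3"
proof -
  have "3 * fps_const (1/3 :: complex) = 1" by (simp add: numeral_fps_const)
  then show ?thesis unfolding chi_odd_def by algebra
qed

lemma chi_parts_square:
  "(1 - 3 * fps_X^2 + 3 * fps_X^4) * (chi_even + chi_odd)^2
    = (1 - 3 * fps_X^2 + 3 * fps_X^4) * eta^2 - 2 * fps_X * (1 + fps_X)"
proof -
  have "3 * (chi_even + chi_odd) = eta_even * rho_inv * (3 - wt^3)"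
    using chi_odd_eq unfolding chi_even_def by algebra
  from chi_square[OF wt_eq wt_deriv wt_units(1,2) eta_even_eq rho_inv_eq this]
  show ?thesis by (simp only: eta_param)
qed

lemma chi_split: "chi = chi_even + chi_odd" and chi_0: "chi $ 0 = 1"
proof -
  define c where "c = chi_even + chi_odd"
  define D :: "complex fps" where "D = 1 - 3 * fps_X^2 + 3 * fps_X^4"
  have D0: "D $ 0 \<noteq> 0" by (simp add: D_def fps_power_zeroth)
  have "(eta^2 - c^2) * D = 2 * fps_X * (1 + fps_X)"
    using chi_parts_square[folded D_def c_def] by algebra
  from fps_div_unit_eq[OF D0 this]
  have sq: "c^2 = eta^2 - 2 * fps_X * (1 + fps_X) / (1 - 3 * fps_X^2 + 3 * fps_X^4)"
    by (simp add: D_def)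
  have c0: "c $ 0 = 1" by (simp add: c_def chi_even_def chi_odd_def fps_power_zeroth)
  then have "(c^2) $ 0 = 1" by (simp add: fps_power_zeroth)
  then show "chi = chi_even + chi_odd"
    unfolding chi_def c_def[symmetric] by (intro fps_sqrt1_unique sq c0) (simp only: sq)
  with c0 show "chi $ 0 = 1" by (simp only: c_def)
qed

lemma J_integrand_square: "(1 - 3 * fps_X^2 + 3 * fps_X^4) * (rho_inv * fps_deriv wt)^2 = 1"
proof -
  define D :: "complex fps" where "D = 1 - 3 * fps_X^2 + 3 * fps_X^4"
  have "3 * (D * (rho_inv * fps_deriv wt)^2) = rho_inv^2 * (3 * (fps_deriv wt)^2 * D)" by algebra
  also have "\<dots> = 3" unfolding D_def param_identities(5)[OF wt_eq wt_deriv wt_units(2)] by (rule rho_inv_eq)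
  finally show ?thesis by (simp add: D_def)
qed

lemma J_deriv: "fps_deriv J_fps = rho_inv * fps_deriv wt"
proof -
  define D :: "complex fps" where "D = 1 - 3 * fps_X^2 + 3 * fps_X^4"
  define s where "s = rho_inv * fps_deriv wt"
  have s0: "s $ 0 = 1" by (simp add: s_def)
  have sD: "D * s^2 = 1" unfolding s_def D_def by (rule J_integrand_square)
  have "fps_sqrt1 D = inverse s"
  proof (rule fps_sqrt1_unique)
    show "D $ 0 = 1" by (simp add: D_def fps_power_zeroth)
    show "inverse s $ 0 = 1" using s0 by simp
    have "s * inverse s = 1" using s0 by (simp add: inverse_mult_eq_1')
    with sD show "(inverse s)^2 = D" by algebra
  qed
  then have "J_fps = fps_integral0 (1 / inverse s)" by (simp add: J_fps_def D_def)
  also have "1 / inverse s = s" using s0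
    by (intro fps_div_unit_eq) (auto simp: inverse_mult_eq_1')
  finally have "J_fps = fps_integral0 s" .
  then have "fps_deriv J_fps = fps_deriv (fps_integral0 s)" by simp
  also have "\<dots> = s" by (rule fps_deriv_fps_integral)
  finally show ?thesis by (simp add: s_def)
qed

lemma J_0 [simp]: "J_fps $ 0 = 0"
  by (simp add: J_fps_def)

section \<open>Initial coefficients\<close>

lemma fps_mult_numeral_nth: "(numeral k * f) $ n = numeral k * f $ n" for f :: "complex fps"
  by (simp add: numeral_fps_const)

text \<open>
  The Taylor polynomials below are verified, not derived: inserted into the equation that
  characterizes the series, they leave an error divisible by a power of \<open>t\<close>. The series \<open>e\<close> in the
  proofs is the cofactor of that power, for denominators cleared.
\<close>

definition eta_tr :: "complex fps" where "eta_tr = fps_const (1/9) * (9 + 9 * fps_X + 9 * fps_X^2 + 15 * fps_X^3 + 9 * fps_X^4 + 21 * fps_X^5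
      + 5 * fps_X^6 + 23 * fps_X^7)"

lemma eta_Taylor: "\<exists>d. eta = eta_tr + fps_X^8 * d"
proof -
  have "9 * fps_const (1/9 :: complex) = 1" by (simp add: numeral_fps_const)
  then have f9: "9 * eta_tr = 9 + 9 * fps_X + 9 * fps_X^2 + 15 * fps_X^3 + 9 * fps_X^4 + 21 * fps_X^5
      + 5 * fps_X^6 + 23 * fps_X^7"
    unfolding eta_tr_def by algebra
  define g where "g = 9 * eta_tr"
  define e :: "complex fps" where "e = -3402 + 1431 * fps_X - 3564 * fps_X^2 - 32724 * fps_X^3 - 44712 * fps_X^4
     - 74304 * fps_X^5 - 100116 * fps_X^6 - 130068 * fps_X^7 - 171414 * fps_X^8 - 176418 * fps_X^9
     - 240478 * fps_X^10 - 211638 * fps_X^11 - 190512 * fps_X^12 - 186136 * fps_X^13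
     - 125778 * fps_X^14 - 137310 * fps_X^15 - 47610 * fps_X^16 - 73002 * fps_X^17"
  have "729 * curve fps_X eta_tr = 729 * (2 + 3 * fps_X) + 243 * fps_X * (1 + fps_X) * g
     - 2 * (1 - 3 * fps_X^2 + 3 * fps_X^4) * g^3"
    unfolding curve_def g_def by (simp add: algebra_simps)
  also have "\<dots> = fps_X^8 * e" unfolding g_def f9 e_def by algebra
  finally have "729 * curve fps_X eta_tr = fps_X^8 * e" .
  from branch_agree[OF eta_is_branch _ this] show ?thesis
    by (auto simp: eta_tr_def fps_power_zeroth)
qed

lemma eta_coeffs: "map (\<lambda>n. fact n * eta $ n) [0..<8] = [1, 1, 2, 10, 24, 280, 400, 12880]"
proof -
  obtain d where d: "eta = eta_tr + fps_X^8 * d" using eta_Taylor by blast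
  show ?thesis unfolding d
    by (simp add: upt_rec eta_tr_def fps_X_power_mult_nth fps_mult_numeral_nth fps_numeral_nth fact_numeral)
qed

text \<open>The sum of the two square roots is a unit, so their difference inherits the divisibility.\<close>

lemma fps_square_agree:
  fixes u v c e :: "complex fps"
  assumes "u $ 0 = 1" "v $ 0 = 1" "c $ 0 \<noteq> 0" "c * (u^2 - v^2) = fps_X^n * e"
  shows "\<exists>d. u = v + fps_X^n * d"
proof -
  define s where "s = c * (u + v)"
  have s0: "s $ 0 \<noteq> 0" using assms by (simp add: s_def)
  have "(u - v) * s = fps_X ^ n * e" unfolding assms(4)[symmetric] s_def by algebra
  then have "(u - v) * (s * inverse s) = fps_X ^ n * (e * inverse s)"
    by (simp add: mult.assoc[symmetric])
  then have "u = v + fps_X ^ n * (e * inverse s)" using s0 by (simp add: inverse_mult_eq_1' algebra_simps)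
  then show ?thesis ..
qed

definition chi_tr :: "complex fps" where "chi_tr = fps_const (1/144) * (144 + 72 * fps_X^2 - 48 * fps_X^3
   + 6 * fps_X^4 - 120 * fps_X^5 - 115 * fps_X^6)"

lemma chi_coeffs: "map (\<lambda>n. fact n * chi $ n) [0..<7] = [1, 0, 1, -2, 1, -100, -575]"
proof -
  obtain d where d: "eta = eta_tr + fps_X^8 * d" using eta_Taylor by blast
  define D :: "complex fps" where "D = 1 - 3 * fps_X^2 + 3 * fps_X^4"
  define c :: "complex fps" where "c = 20736 * D"
  define e :: "complex fps" where "e = - 60480 - 57204 * fps_X + 39744 * fps_X^2 + 97920 * fps_X^3
    + 375792 * fps_X^4 + 289935 * fps_X^5 + 357104 * fps_X^6 + 312679 * fps_X^7 + 219792 * fps_X^8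
    + 315141 * fps_X^9 + 176640 * fps_X^10 + 406272 * fps_X^11"
  have "144 * fps_const (1/144 :: complex) = 1" "9 * fps_const (1/9 :: complex) = 1" by (simp_all add: numeral_fps_const)
  then have g: "144 * chi_tr = 144 + 72 * fps_X^2 - 48 * fps_X^3 + 6 * fps_X^4 - 120 * fps_X^5 - 115 * fps_X^6"
   and f: "9 * eta_tr = 9 + 9 * fps_X + 9 * fps_X^2 + 15 * fps_X^3 + 9 * fps_X^4 + 21 * fps_X^5
      + 5 * fps_X^6 + 23 * fps_X^7"
    unfolding chi_tr_def eta_tr_def by algebra+
  have "c * (chi^2 - chi_tr^2) = 20736 * (D * eta^2 - 2 * fps_X * (1 + fps_X)) - D * (144 * chi_tr)^2"
    unfolding c_def using chi_parts_square[folded D_def chi_split] by algebra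
  also have "\<dots> = 256 * D * (9 * eta_tr)^2 - 41472 * fps_X * (1 + fps_X) - D * (144 * chi_tr)^2
      + fps_X^7 * (20736 * D * (2 * eta_tr * fps_X * d + fps_X^9 * d^2))"
    unfolding d by algebra
  also have "256 * D * (9 * eta_tr)^2 - 41472 * fps_X * (1 + fps_X) - D * (144 * chi_tr)^2 = fps_X^7 * e"
    unfolding f g e_def D_def by algebra
  also have "fps_X^7 * e + fps_X^7 * (20736 * D * (2 * eta_tr * fps_X * d + fps_X^9 * d^2))
     = fps_X^7 * (e + 20736 * D * (2 * eta_tr * fps_X * d + fps_X^9 * d^2))" by (simp add: distrib_left)
  finally have "c * (chi^2 - chi_tr^2) = \<dots>" .
  from fps_square_agree[OF chi_0 _ _ this] obtain d where d: "chi = chi_tr + fps_X^7 * d"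
    by (auto simp: chi_tr_def c_def D_def fps_power_zeroth)
  show ?thesis unfolding d
    by (simp add: upt_rec chi_tr_def fps_X_power_mult_nth fps_mult_numeral_nth fps_numeral_nth fact_numeral)
qed

definition dJ_tr :: "complex fps" where "dJ_tr = fps_const (1/128) *
   (128 + 192 * fps_X^2 + 240 * fps_X^4 + 216 * fps_X^6 + 27 * fps_X^8)"

lemma J_coeffs: "map (\<lambda>n. fact n * J_fps $ n) [0..<10] = [0, 1, 0, 3, 0, 45, 0, 1215, 0, 8505]"
proof -
  define D :: "complex fps" where "D = 1 - 3 * fps_X^2 + 3 * fps_X^4"
  define e :: "complex fps" where "e = - 114048 - 159840 * fps_X^2 - 174960 * fps_X^4 - 144585 * fps_X^6
     - 32805 * fps_X^8 - 2187 * fps_X^10"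
  have "128 * fps_const (1/128 :: complex) = 1" by (simp_all add: numeral_fps_const)
  then have g: "128 * dJ_tr = 128 + 192 * fps_X^2 + 240 * fps_X^4 + 216 * fps_X^6 + 27 * fps_X^8"
    unfolding dJ_tr_def by algebra
  have "(16384 * D) * ((fps_deriv J_fps)^2 - dJ_tr^2) = 16384 - D * (128 * dJ_tr)^2"
    using J_integrand_square[folded D_def J_deriv] by algebra
  also have "\<dots> = fps_X^10 * e" unfolding g e_def D_def by algebra
  finally have sq: "(16384 * D) * ((fps_deriv J_fps)^2 - dJ_tr^2) = fps_X^10 * e" .
  have J1: "fps_deriv J_fps $ 0 = 1" unfolding J_deriv by simp
  from fps_square_agree[OF J1 _ _ sq] obtain d where d: "fps_deriv J_fps = dJ_tr + fps_X^10 * d"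
    by (auto simp: dJ_tr_def D_def fps_power_zeroth)
  have "J_fps $ n = (dJ_tr + fps_X^10 * d) $ (n - 1) / of_nat n" if "n > 0" for n
    using that unfolding d[symmetric] by (cases n) (simp_all del: of_nat_Suc)
  note coeff = this[of 1] this[of 2] this[of 3] this[of 4] this[of 5] this[of 6] this[of 7] this[of 8] this[of 9]
  have J_values: "J_fps $ Suc 0 = 1" "J_fps $ 2 = 0" "J_fps $ 3 = 1/2" "J_fps $ 4 = 0" "J_fps $ 5 = 3/8"
    "J_fps $ 6 = 0" "J_fps $ 7 = 27/112" "J_fps $ 8 = 0" "J_fps $ 9 = 3/128"
    using coeff
    by (simp_all add: dJ_tr_def fps_X_power_mult_nth fps_mult_numeral_nth fps_numeral_nth)
  have "[0..<10] = [0, Suc 0, 2, 3, 4, 5, 6, 7, 8, 9 :: nat]"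
    by (simp add: upt_rec eval_nat_numeral)
  then show ?thesis by (simp add: J_values fact_numeral)
qed

section \<open>Genus\<close>

text \<open>
  The value \<open>P(w)\<close> as a Laurent series in \<open>t\<close>. Composition of power series makes it an injective
  ring homomorphism, by which elements of \<open>\<complex>(w)\<close> are handled as fractions of polynomials.
\<close>

definition eval_w :: "complex poly \<Rightarrow> complex fls" where
  "eval_w P = fps_to_fls (fps_of_poly P oo wt)"

lemma eval_w_0 [simp]: "eval_w 0 = 0" and eval_w_1 [simp]: "eval_w 1 = 1"
  and eval_w_add: "eval_w (P + Q) = eval_w P + eval_w Q"
  and eval_w_diff: "eval_w (P - Q) = eval_w P - eval_w Q"
  and eval_w_uminus: "eval_w (- P) = - eval_w P"
  and eval_w_mult: "eval_w (P * Q) = eval_w P * eval_w Q"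
  and eval_w_const: "eval_w [:c:] = fls_const c"
  and eval_w_X: "eval_w [:0, 1:] = fps_to_fls wt"
  by (simp_all add: eval_w_def fps_of_poly_add fps_of_poly_diff fps_of_poly_uminus fps_of_poly_mult
      fps_compose_add_distrib fps_compose_sub_distrib fps_compose_uminus fps_compose_mult_distrib fls_times_fps_to_fls
      fps_of_poly_const)

lemma eval_w_pCons: "eval_w (pCons c P) = fls_const c + fps_to_fls wt * eval_w P"
proof -
  have "pCons c P = [:c:] + [:0, 1:] * P" by simp
  then show ?thesis by (simp only: eval_w_add eval_w_mult eval_w_const eval_w_X)
qed

lemma eval_w_eq_0_iff [simp]: "eval_w P = 0 \<longleftrightarrow> P = 0"
proof -
  have "wt \<noteq> 0" using wt_1 by (metis fps_zero_nth zero_neq_one)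
  then have "fps_of_poly P oo wt = 0 \<longleftrightarrow> fps_of_poly P = 0"
    by (subst fps_compose_eq_0_iff) auto
  also have "\<dots> \<longleftrightarrow> P = 0" by (metis fps_of_poly_0 fps_of_poly_eq_iff)
  finally show ?thesis by (simp add: eval_w_def)
qed

lemma eval_w_eq_iff [simp]: "eval_w P = eval_w Q \<longleftrightarrow> P = Q"
  using eval_w_eq_0_iff[of "P - Q"] by (simp only: eval_w_diff right_minus_eq)

lemma eval_w_frac_eq_iff:
  assumes "Q \<noteq> 0" "S \<noteq> 0"
  shows "eval_w P / eval_w Q = eval_w R / eval_w S \<longleftrightarrow> P * S = R * Q"
  using assms by (simp add: frac_eq_eq flip: eval_w_mult)

text \<open>
  The field \<open>\<complex>(w)\<close> and those of its valuation rings that detect regularity: functions without a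
  pole at \<open>w = a\<close>, and functions without a pole at \<open>w = \<infinity>\<close>.
\<close>

definition ratfield :: "complex fls set" where
  "ratfield = {eval_w P / eval_w Q | P Q. Q \<noteq> 0}"

definition ring_at :: "complex \<Rightarrow> complex fls set" where
  "ring_at a = {eval_w P / eval_w Q | P Q. poly Q a \<noteq> 0}"

definition ring_at_infinity :: "complex fls set" where
  "ring_at_infinity = {eval_w P / eval_w Q | P Q. Q \<noteq> 0 \<and> degree P \<le> degree Q}"

text \<open>
  The common part of the closure properties of the three sets: the predicate \<open>M\<close> describes the
  admitted pairs of numerator and denominator.
\<close>

lemma const_subalgebra_fractions:
  assumes one: "\<And>P. degree P = 0 \<Longrightarrow> M P 1"
    and nz: "\<And>P Q. M P Q \<Longrightarrow> Q \<noteq> 0"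
    and add: "\<And>P Q R S. M P Q \<Longrightarrow> M R S \<Longrightarrow> M (P * S + R * Q) (Q * S)"
    and mult: "\<And>P Q R S. M P Q \<Longrightarrow> M R S \<Longrightarrow> M (P * R) (Q * S)"
  shows "const_subalgebra {eval_w P / eval_w Q | P Q. M P Q}"
  unfolding const_subalgebra_def
proof (intro conjI subsetI ballI)
  fix x :: "complex fls" assume "x \<in> range fls_const"
  then obtain c where "x = fls_const c" by blast
  then have "x = eval_w [:c:] / eval_w 1" by (simp add: eval_w_const)
  moreover have "M [:c:] 1" by (rule one) simp
  ultimately show "x \<in> {eval_w P / eval_w Q | P Q. M P Q}" by blast
next
  fix x y assume "x \<in> {eval_w P / eval_w Q | P Q. M P Q}" "y \<in> {eval_w P / eval_w Q | P Q. M P Q}"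
  then obtain P Q R S where *: "x = eval_w P / eval_w Q" "M P Q" "y = eval_w R / eval_w S" "M R S" by blast
  with nz have [simp]: "Q \<noteq> 0" "S \<noteq> 0" by blast+
  have "x + y = eval_w (P * S + R * Q) / eval_w (Q * S)"
    by (simp add: * eval_w_add eval_w_mult add_frac_eq)
  with add[OF *(2,4)] show "x + y \<in> {eval_w P / eval_w Q | P Q. M P Q}" by blast
  have "x * y = eval_w (P * R) / eval_w (Q * S)" by (simp add: * eval_w_mult)
  with mult[OF *(2,4)] show "x * y \<in> {eval_w P / eval_w Q | P Q. M P Q}" by blast
qed

lemma const_subalgebra_ratfield: "const_subalgebra ratfield"
  unfolding ratfield_def by (rule const_subalgebra_fractions) auto

lemma const_subalgebra_ring_at: "const_subalgebra (ring_at a)"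
  unfolding ring_at_def by (rule const_subalgebra_fractions) auto

lemma const_subalgebra_ring_at_infinity: "const_subalgebra ring_at_infinity"
  unfolding ring_at_infinity_def
proof (rule const_subalgebra_fractions)
  fix P Q R S :: "complex poly"
  assume *: "Q \<noteq> 0 \<and> degree P \<le> degree Q" "S \<noteq> 0 \<and> degree R \<le> degree S"
  have "degree (P * S) \<le> degree Q + degree S" "degree (R * Q) \<le> degree Q + degree S"
    "degree (P * R) \<le> degree Q + degree S"
    using * degree_mult_le[of P S] degree_mult_le[of R Q] degree_mult_le[of P R] by linarith+
  with * show "Q * S \<noteq> 0 \<and> degree (P * S + R * Q) \<le> degree (Q * S)"
    "Q * S \<noteq> 0 \<and> degree (P * R) \<le> degree (Q * S)"
    by (auto simp: degree_mult_eq degree_add_le)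
qed auto

lemma inverse_in_ratfield: "x \<in> ratfield \<Longrightarrow> inverse x \<in> ratfield"
proof -
  assume "x \<in> ratfield"
  then obtain P Q where x: "x = eval_w P / eval_w Q" "Q \<noteq> 0" unfolding ratfield_def by blast
  show ?thesis
  proof (cases "P = 0")
    case True
    then show ?thesis using x by (auto simp: ratfield_def)
  next
    case False
    then show ?thesis unfolding ratfield_def using x by (auto simp: inverse_eq_divide)
  qed
qed

lemma ratfield_least:
  assumes K: "const_subalgebra K" "\<forall>x\<in>K. inverse x \<in> K" and w: "fps_to_fls wt \<in> K"
  shows "ratfield \<subseteq> K"
proof
  have eval_w: "eval_w P \<in> K" for P
  proof (induction P)
    case 0
    have "fls_const 0 \<in> K" using K(1) by (auto simp: const_subalgebra_def)
    then show ?case by simp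
  next
    case (pCons c P)
    then show ?case using K(1) w unfolding eval_w_pCons const_subalgebra_def by blast
  qed
  fix x assume "x \<in> ratfield"
  then show "x \<in> K" unfolding ratfield_def using eval_w K
    by (auto simp: divide_inverse const_subalgebra_def)
qed

lemma wt_eq_fls: "3 * fls_X * (fps_to_fls wt^2 + 1) = fps_to_fls wt^3 + 3 * fps_to_fls wt"
  using arg_cong[OF wt_eq, of fps_to_fls] by (simp add: fls_times_fps_to_fls fps_to_fls_power)

lemma eta_eq_fls:
  "fps_to_fls eta * (fps_to_fls wt^4 + 3) = 3 * (fps_to_fls wt + 1) * (fps_to_fls wt^2 + 1)"
proof -
  have "eta * (wt^4+3) = 3 * (wt+1) * (wt^2+1)" using eta_even_eq unfolding eta_param by algebra
  from arg_cong[OF this, of fps_to_fls] show ?thesis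
    by (simp add: fls_times_fps_to_fls fps_to_fls_power)
qed

text \<open>
  The formula of \<open>param_rational\<close> expresses \<open>w\<close> by \<open>t\<close> and \<open>\<eta>\<close>. Its denominator is not zero, since it
  takes the value 144 at the point \<open>(0, 1)\<close>.
\<close>

lemma wt_in_field:
  assumes K: "const_subalgebra K" "\<forall>x\<in>K. inverse x \<in> K" "fls_X \<in> K" "fps_to_fls eta \<in> K"
  shows "fps_to_fls wt \<in> K"
proof -
  have add: "x + y \<in> K" and mult: "x * y \<in> K" if "x \<in> K" "y \<in> K" for x y
    using K(1) that by (auto simp: const_subalgebra_def)
  have const: "fls_const c \<in> K" for c using K(1) by (auto simp: const_subalgebra_def)
  have num: "numeral k \<in> K" for k using const[of "numeral k"] by simp
  have one: "1 \<in> K" using const[of 1] by simp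
  have diff: "x - y \<in> K" if "x \<in> K" "y \<in> K" for x y
  proof -
    have "x - y = x + fls_const (-1) * y" by simp
    then show ?thesis using add mult const that by metis
  qed
  define x y :: "complex fls" where "x = fls_X" and "y = fps_to_fls eta"
  have xy: "x \<in> K" "y \<in> K" using K by (simp_all add: x_def y_def)
  have "param_den x y \<in> K" "param_num x y \<in> K"
    unfolding param_den_def param_num_def quad2_def quad1_def quad0_def power2_eq_square
    by (intro add mult num one diff xy)+
  then have "param_num x y * inverse (param_den x y) \<in> K"
    using K(2) mult by blast
  moreover have "param_num x y = fps_to_fls wt * param_den x y"
    unfolding x_def y_def using param_rational[OF wt_eq_fls eta_eq_fls] by simp
  moreover have "param_den x y \<noteq> 0"
  proof -
    have "eta $ 0 = 1" using eta_is_branch by (simp add: is_branch_def)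
    then have "param_den fps_X eta $ 0 = 144"
      by (simp add: param_den_def quad2_def quad1_def quad0_def fps_power_zeroth)
    then have "param_den fps_X eta \<noteq> 0" by auto
    moreover have "fps_to_fls (param_den fps_X eta) = param_den x y"
      by (simp add: param_den_def quad2_def quad1_def quad0_def x_def y_def fls_times_fps_to_fls fps_to_fls_power)
    ultimately show ?thesis by (metis fps_to_fls_eq_0_iff)
  qed
  ultimately show ?thesis by (metis divide_inverse nonzero_eq_divide_eq)
qed

lemma X_in_ratfield: "fls_X \<in> ratfield"
proof -
  have "eval_w [:3, 0, 3:] = 3 * (fps_to_fls wt^2 + 1)" "eval_w [:0, 3, 0, 1:] = fps_to_fls wt^3 + 3 * fps_to_fls wt"
    by (simp_all add: eval_w_pCons algebra_simps power2_eq_square power3_eq_cube)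
  with wt_eq_fls have "fls_X * eval_w [:3, 0, 3:] = eval_w [:0, 3, 0, 1:]" by algebra
  then have "fls_X = eval_w [:0, 3, 0, 1:] / eval_w [:3, 0, 3:]" by (simp add: nonzero_eq_divide_eq)
  then show ?thesis unfolding ratfield_def by force
qed

lemma eta_in_ratfield: "fps_to_fls eta \<in> ratfield"
proof -
  have "eval_w [:3, 0, 0, 0, 1:] = fps_to_fls wt^4 + 3" "eval_w [:3, 3, 3, 3:] = 3 * (fps_to_fls wt + 1) * (fps_to_fls wt^2 + 1)"
    by (simp_all add: eval_w_pCons algebra_simps eval_nat_numeral)
  with eta_eq_fls have "fps_to_fls eta * eval_w [:3, 0, 0, 0, 1:] = eval_w [:3, 3, 3, 3:]" by simp
  then have "fps_to_fls eta = eval_w [:3, 3, 3, 3:] / eval_w [:3, 0, 0, 0, 1:]" by (simp add: nonzero_eq_divide_eq)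
  then show ?thesis unfolding ratfield_def by force
qed

lemma function_field_eta: "function_field (fps_to_fls eta) = ratfield"
proof
  show "function_field (fps_to_fls eta) \<subseteq> ratfield"
    unfolding function_field_def
    using const_subalgebra_ratfield inverse_in_ratfield X_in_ratfield eta_in_ratfield by blast
  show "ratfield \<subseteq> function_field (fps_to_fls eta)"
    unfolding function_field_def using ratfield_least wt_in_field by blast
qed

lemma coprime_fraction:
  assumes "x \<in> ratfield"
  obtains P Q where "x = eval_w P / eval_w Q" "Q \<noteq> 0" "coprime P Q"
proof -
  obtain P Q where x: "x = eval_w P / eval_w Q" "Q \<noteq> 0" using assms unfolding ratfield_def by blast
  then have "gcd P Q \<noteq> 0" by simp
  from gcd_coprime_exists[OF this] obtain P' Q'
    where *: "P = P' * gcd P Q" "Q = Q' * gcd P Q" "coprime P' Q'" by blast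
  with x(2) have "Q' \<noteq> 0" by auto
  moreover have "P * Q' = P' * Q" using *(1,2) by (metis mult.assoc mult.commute)
  ultimately have "x = eval_w P' / eval_w Q'" using x by (simp add: eval_w_frac_eq_iff)
  with \<open>Q' \<noteq> 0\<close> *(3) show ?thesis using that by blast
qed

lemma coprime_no_common_root:
  assumes "coprime P Q" "poly P a = 0" "poly Q (a::complex) = 0"
  shows False
  using assms by (metis coprime_poly_0)

lemma eval_w_linear: "eval_w [:-a, 1:] = fps_to_fls wt - fls_const a"
  by (simp add: eval_w_pCons)

lemma linear_inverse_notin_ring_at: "inverse (eval_w [:-a, 1:]) \<notin> ring_at a"
proof
  assume "inverse (eval_w [:-a, 1:]) \<in> ring_at a"
  then obtain P Q where "eval_w 1 / eval_w [:-a, 1:] = eval_w P / eval_w Q" "poly Q a \<noteq> 0"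
    unfolding ring_at_def by (auto simp: inverse_eq_divide)
  moreover from this have "Q \<noteq> 0" by auto
  ultimately have "1 * Q = P * [:-a, 1:]" by (subst (asm) eval_w_frac_eq_iff) auto
  with \<open>poly Q a \<noteq> 0\<close> show False by simp
qed

lemma is_place_ring_at: "is_place ratfield (ring_at a)"
  unfolding is_place_def
proof (intro conjI ballI)
  show "const_subalgebra (ring_at a)" by (rule const_subalgebra_ring_at)
  have "ring_at a \<subseteq> ratfield" unfolding ring_at_def ratfield_def by force
  moreover have "inverse (eval_w [:-a, 1:]) \<in> ratfield"
  proof -
    have "inverse (eval_w [:-a, 1:]) = eval_w 1 / eval_w [:-a, 1:]" by (simp add: inverse_eq_divide)
    moreover have "[:-a, 1:] \<noteq> 0" by simp
    ultimately show ?thesis unfolding ratfield_def by blast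
  qed
  ultimately show "ring_at a \<subset> ratfield" using linear_inverse_notin_ring_at by blast
  fix x assume "x \<in> ratfield"
  then obtain P Q where x: "x = eval_w P / eval_w Q" "Q \<noteq> 0" "coprime P Q" by (rule coprime_fraction)
  with coprime_no_common_root have "poly P a \<noteq> 0 \<or> poly Q a \<noteq> 0" by blast
  then show "x \<in> ring_at a \<or> inverse x \<in> ring_at a"
    unfolding ring_at_def x(1) by (auto simp: inverse_eq_divide)
qed

lemma is_uniformizer_ring_at: "is_uniformizer (ring_at a) (eval_w [:-a, 1:])"
  unfolding is_uniformizer_def
proof (intro conjI equalityI subsetI)
  have p: "eval_w [:-a, 1:] \<in> ring_at a"
  proof -
    have "eval_w [:-a, 1:] = eval_w [:-a, 1:] / eval_w 1" by simp
    then show ?thesis unfolding ring_at_def by (metis (mono_tags, lifting) mem_Collect_eq poly_1 zero_neq_one)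
  qed
  then show "eval_w [:-a, 1:] \<in> ring_at a" .
  fix x
  { assume "x \<in> {x \<in> ring_at a. x = 0 \<or> inverse x \<notin> ring_at a}"
    then obtain P Q where x: "x = eval_w P / eval_w Q" "poly Q a \<noteq> 0" "x = 0 \<or> inverse x \<notin> ring_at a"
      unfolding ring_at_def by blast
    have "poly P a = 0"
    proof (rule ccontr)
      assume *: "poly P a \<noteq> 0"
      then have "inverse x \<in> ring_at a" using x unfolding ring_at_def by (auto simp: inverse_eq_divide)
      moreover have "x \<noteq> 0" using * x by auto
      ultimately show False using x(3) by blast
    qed
    then obtain R where "P = [:-a, 1:] * R" by (auto simp: poly_eq_0_iff_dvd)
    then have "x = eval_w [:-a, 1:] * (eval_w R / eval_w Q)" by (simp only: x(1) eval_w_mult times_divide_eq_right)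
    moreover have "eval_w R / eval_w Q \<in> ring_at a" unfolding ring_at_def using x(2) by blast
    ultimately show "x \<in> (*) (eval_w [:-a, 1:]) ` ring_at a" by blast }
  { assume "x \<in> (*) (eval_w [:-a, 1:]) ` ring_at a"
    then obtain y where y: "y \<in> ring_at a" "x = eval_w [:-a, 1:] * y" by blast
    have mult: "u * v \<in> ring_at a" if "u \<in> ring_at a" "v \<in> ring_at a" for u v
      using const_subalgebra_ring_at[of a] that by (simp add: const_subalgebra_def)
    have "x = 0" if "inverse x \<in> ring_at a"
    proof (rule ccontr)
      assume "x \<noteq> 0"
      then have "inverse (eval_w [:-a, 1:]) = inverse x * y" using y by (auto simp: field_simps)
      with mult[OF that y(1)] linear_inverse_notin_ring_at show False by metis
    qed
    moreover have "x \<in> ring_at a" using mult[OF p y(1)] y(2) by simp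
    ultimately show "x \<in> {x \<in> ring_at a. x = 0 \<or> inverse x \<notin> ring_at a}" by blast }
qed

lemma wt_notin_ring_at_infinity: "eval_w [:0, 1:] \<notin> ring_at_infinity"
proof
  assume "eval_w [:0, 1:] \<in> ring_at_infinity"
  then obtain P Q where "eval_w [:0, 1:] / eval_w 1 = eval_w P / eval_w Q" "Q \<noteq> 0" "degree P \<le> degree Q"
    unfolding ring_at_infinity_def by auto
  then have "[:0, 1:] * Q = P * 1" by (subst (asm) eval_w_frac_eq_iff) auto
  then have "P = [:0, 1:] * Q" by simp
  moreover have "degree ([:0, 1:] * Q) = Suc (degree Q)" using \<open>Q \<noteq> 0\<close> by (subst degree_mult_eq) auto
  ultimately show False using \<open>degree P \<le> degree Q\<close> by simp
qed

lemma is_place_ring_at_infinity: "is_place ratfield ring_at_infinity"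
  unfolding is_place_def
proof (intro conjI ballI)
  show "const_subalgebra ring_at_infinity" by (rule const_subalgebra_ring_at_infinity)
  have "ring_at_infinity \<subseteq> ratfield" unfolding ring_at_infinity_def ratfield_def by blast
  moreover have "eval_w [:0, 1:] \<in> ratfield"
  proof -
    have "eval_w [:0, 1:] = eval_w [:0, 1:] / eval_w 1" by simp
    then show ?thesis unfolding ratfield_def by (metis (mono_tags, lifting) mem_Collect_eq one_neq_zero)
  qed
  ultimately show "ring_at_infinity \<subset> ratfield" using wt_notin_ring_at_infinity by blast
  fix x assume "x \<in> ratfield"
  then obtain P Q where x: "x = eval_w P / eval_w Q" "Q \<noteq> 0" unfolding ratfield_def by blast
  show "x \<in> ring_at_infinity \<or> inverse x \<in> ring_at_infinity"
  proof (cases "degree P \<le> degree Q")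
    case True
    then show ?thesis unfolding ring_at_infinity_def using x by blast
  next
    case False
    then have "inverse x = eval_w Q / eval_w P" "P \<noteq> 0" "degree Q \<le> degree P" using x by auto
    then show ?thesis unfolding ring_at_infinity_def by blast
  qed
qed

lemma is_uniformizer_ring_at_infinity: "is_uniformizer ring_at_infinity (inverse (eval_w [:0, 1:]))"
  unfolding is_uniformizer_def
proof (intro conjI equalityI subsetI)
  have "inverse (eval_w [:0, 1:]) = eval_w 1 / eval_w [:0, 1:]" by (simp add: inverse_eq_divide)
  moreover have "[:0, 1:] \<noteq> (0 :: complex poly)" "degree (1::complex poly) \<le> degree [:0, 1::complex:]" by auto
  ultimately show p: "inverse (eval_w [:0, 1:]) \<in> ring_at_infinity" unfolding ring_at_infinity_def by blast
  fix x
  { assume "x \<in> {x \<in> ring_at_infinity. x = 0 \<or> inverse x \<notin> ring_at_infinity}"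
    then obtain P Q where x: "x = eval_w P / eval_w Q" "Q \<noteq> 0" "degree P \<le> degree Q"
        "x = 0 \<or> inverse x \<notin> ring_at_infinity"
      unfolding ring_at_infinity_def by blast
    have "P = 0 \<or> degree P < degree Q"
    proof (rule ccontr)
      assume *: "\<not> (P = 0 \<or> degree P < degree Q)"
      then have "inverse x = eval_w Q / eval_w P" "P \<noteq> 0" "degree Q \<le> degree P" using x by auto
      then have "inverse x \<in> ring_at_infinity" unfolding ring_at_infinity_def by blast
      moreover have "x \<noteq> 0" using * x by auto
      ultimately show False using x(4) by blast
    qed
    then have "degree ([:0, 1:] * P) \<le> degree Q"
      by (cases "P = 0") (auto simp: degree_mult_eq)
    then have "eval_w ([:0, 1:] * P) / eval_w Q \<in> ring_at_infinity" unfolding ring_at_infinity_def using x(2) by blast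
    moreover have "x = inverse (eval_w [:0, 1:]) * (eval_w ([:0, 1:] * P) / eval_w Q)"
      unfolding x(1) eval_w_mult by (simp add: field_simps)
    ultimately show "x \<in> (*) (inverse (eval_w [:0, 1:])) ` ring_at_infinity" by blast }
  { assume "x \<in> (*) (inverse (eval_w [:0, 1:])) ` ring_at_infinity"
    then obtain y where y: "y \<in> ring_at_infinity" "x = inverse (eval_w [:0, 1:]) * y" by blast
    have mult: "u * v \<in> ring_at_infinity" if "u \<in> ring_at_infinity" "v \<in> ring_at_infinity" for u v
      using const_subalgebra_ring_at_infinity that by (simp add: const_subalgebra_def)
    have "x = 0" if "inverse x \<in> ring_at_infinity"
    proof (rule ccontr)
      assume "x \<noteq> 0"
      then have "eval_w [:0, 1:] = inverse x * y" using y by (auto simp: field_simps)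
      with mult[OF that y(1)] wt_notin_ring_at_infinity show False by metis
    qed
    moreover have "x \<in> ring_at_infinity" using mult[OF p y(1)] y(2) by simp
    ultimately show "x \<in> {x \<in> ring_at_infinity. x = 0 \<or> inverse x \<notin> ring_at_infinity}" by blast }
qed

text \<open>In lowest terms, a root of the denominator would be a pole.\<close>

lemma in_all_rings_at_imp_polynomial:
  assumes "\<And>a. x \<in> ring_at a"
  obtains P where "x = eval_w P"
proof -
  have "x \<in> ratfield" using assms[of 0] unfolding ring_at_def ratfield_def by force
  then obtain P Q where x: "x = eval_w P / eval_w Q" "Q \<noteq> 0" "coprime P Q" by (rule coprime_fraction)
  have "degree Q = 0"
  proof (rule ccontr)
    assume "degree Q \<noteq> 0"
    then obtain a where a: "poly Q a = 0" using alg_closed_imp_poly_has_root[of Q] by auto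
    from assms[of a] obtain R S where *: "x = eval_w R / eval_w S" "poly S a \<noteq> 0" unfolding ring_at_def by blast
    then have "S \<noteq> 0" by auto
    with * x have "P * S = R * Q" by (simp add: eval_w_frac_eq_iff)
    then have "poly P a * poly S a = poly R a * poly Q a" by (metis poly_mult)
    with a * have "poly P a = 0" by simp
    with a x(3) show False using coprime_no_common_root by blast
  qed
  then obtain c where c: "Q = [:c:]" "c \<noteq> 0" using x(2) by (metis degree_eq_zeroE pCons_0_0)
  have "P * 1 = ([:1/c:] * P) * Q" using c by simp
  then have "x = eval_w ([:1/c:] * P) / eval_w 1" unfolding x(1) using x(2) by (subst eval_w_frac_eq_iff) auto
  then show ?thesis using that by simp
qed

text \<open>
  Let \<open>f dt\<close> be regular. The uniformizer \<open>w - a\<close> at a finite point has derivative \<open>w'\<close>, so \<open>f / w'\<close> has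
  no finite pole and equals \<open>G(w)\<close> for a polynomial \<open>G\<close>. The uniformizer \<open>1 / w\<close> at infinity has
  derivative \<open>- w' / w\<^sup>2\<close>, so \<open>- w\<^sup>2 G(w)\<close> is bounded there, which is possible for \<open>G = 0\<close> only.
\<close>

lemma regular_differentials_ratfield: "regular_differentials ratfield = {0}"
proof (intro equalityI subsetI)
  fix f assume "f \<in> regular_differentials ratfield"
  then have f: "f \<in> ratfield" "\<And>V p. is_place ratfield V \<Longrightarrow> is_uniformizer V p \<Longrightarrow> f / fls_deriv p \<in> V"
    unfolding regular_differentials_def by blast+
  define w where "w = eval_w [:0, 1:]"
  have w0: "w \<noteq> 0" by (simp add: w_def)
  have dw0: "fls_deriv w \<noteq> 0"
  proof
    assume "fls_deriv w = 0"
    then have "fps_deriv wt = 0" by (simp add: w_def eval_w_X fls_deriv_fps_to_fls)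
    then have "fps_deriv wt $ 0 = 0" by simp
    then show False by simp
  qed
  have "f / fls_deriv w \<in> ring_at a" for a
  proof -
    have "fls_deriv (eval_w [:-a, 1:]) = fls_deriv w"
      by (simp add: w_def eval_w_linear eval_w_X)
    then show ?thesis using f(2)[OF is_place_ring_at is_uniformizer_ring_at, of a] by simp
  qed
  then obtain G where G: "f / fls_deriv w = eval_w G" by (rule in_all_rings_at_imp_polynomial)
  have "fls_deriv (w * inverse w) = 0" using w0 by simp
  then have "fls_deriv w * inverse w + w * fls_deriv (inverse w) = 0" by (simp add: add.commute)
  then have dinv: "fls_deriv (inverse w) = - fls_deriv w / w^2"
    using w0 by (simp add: field_simps power2_eq_square add_eq_0_iff2)
  have "eval_w [:0,0,1:] = w^2" by (simp add: w_def eval_w_pCons power2_eq_square)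
  then have "f / fls_deriv (inverse w) = eval_w (- ([:0,0,1:] * G))"
    unfolding dinv eval_w_uminus eval_w_mult G[symmetric] by simp
  then have "eval_w (- ([:0,0,1:] * G)) \<in> ring_at_infinity"
    using f(2)[OF is_place_ring_at_infinity is_uniformizer_ring_at_infinity] unfolding w_def by simp
  then obtain P Q where *: "eval_w (- ([:0,0,1:] * G)) / eval_w 1 = eval_w P / eval_w Q" "Q \<noteq> 0" "degree P \<le> degree Q"
    unfolding ring_at_infinity_def by auto
  then have "- ([:0,0,1:] * G) * Q = P * 1" by (subst (asm) eval_w_frac_eq_iff) auto
  then have "degree P = degree ([:0,0,1:] * G * Q)" by (metis degree_minus mult.right_neutral mult_minus_left)
  moreover have "degree ([:0,0,1:] * G * Q) = 2 + degree G + degree Q" if "G \<noteq> 0"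
    using that *(2) by (simp add: degree_mult_eq del: mult_pCons_left)
  ultimately have "G = 0" using *(3) by fastforce
  with G dw0 show "f \<in> {0}" by simp
next
  fix f :: "complex fls" assume "f \<in> {0}"
  moreover have zero: "0 \<in> V" if "const_subalgebra V" for V
  proof -
    have "fls_const 0 \<in> V" using that unfolding const_subalgebra_def by blast
    then show ?thesis by simp
  qed
  have "0 \<in> ratfield" by (rule zero) (rule const_subalgebra_ratfield)
  moreover have "0 \<in> V" if "is_place ratfield V" for V
    using that zero by (simp add: is_place_def)
  ultimately show "f \<in> regular_differentials ratfield" by (simp add: regular_differentials_def)
qed

lemma genus_0: "has_genus (function_field (fps_to_fls eta)) 0"
proof -
  interpret vector_space "\<lambda>c f. fls_const c * f"
    by standard (simp_all add: algebra_simps flip: fls_plus_const)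
  show ?thesis
    unfolding has_genus_def function_field_eta regular_differentials_ratfield
    by (rule exI[of _ "{}"]) (simp add: independent_empty)
qed

section \<open>The generating function\<close>

lemma eta_even_deriv: "fps_deriv eta_even * (wt^4+3) + 4*eta_even*wt^3*fps_deriv wt = 6*wt*fps_deriv wt"
proof -
  have "fps_deriv (eta_even * (wt^4+3)) = fps_deriv (3 * (wt^2 + 1))" by (simp only: eta_even_eq)
  then show ?thesis by (simp add: power2_eq_square eval_nat_numeral algebra_simps)
qed

text \<open>
  The logarithmic derivative of \<open>h / \<rho>\<close> is a rational function of \<open>w\<close> times \<open>w'\<close>; the two summands on
  the right come from \<open>h\<close> and from \<open>1 / \<rho>\<close>.
\<close>

lemma chi_even_deriv:
  defines "p \<equiv> fps_deriv wt"
  shows "fps_deriv chi_even * ((wt^2+1)*(wt^4+3)*(wt^4+3*wt^2+3)) =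
     - chi_even * p * wt * (2*(wt^2+3)*(wt^2-1)*(wt^4+3*wt^2+3) + (2*wt^2+3)*(wt^2+1)*(wt^4+3))"
proof -
  have 1: "fps_deriv eta_even * (wt^4+3) * (wt^2+1) = - (eta_even * p * 2 * wt * (wt^2+3) * (wt^2-1))"
  proof -
    have "(wt^4+3) * (fps_deriv eta_even * (wt^4+3) * (wt^2+1) + eta_even * p * 2 * wt * (wt^2+3) * (wt^2-1)) = 0"
      using eta_even_deriv eta_even_eq unfolding p_def by algebra
    then show ?thesis using wt_units(2) by (simp add: add_eq_0_iff2 del: wt_units(2))
  qed
  have "fps_deriv (rho_inv^2 * (wt^4+3*wt^2+3)) = 0" unfolding rho_inv_eq by simp
  then have "2 * rho_inv * (fps_deriv rho_inv * (wt^4+3*wt^2+3) + rho_inv * (2*wt^3+3*wt) * p) = 0"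
    unfolding p_def by (simp add: power2_eq_square eval_nat_numeral algebra_simps)
  moreover have "rho_inv \<noteq> 0" using rho_inv_0 by (metis fps_zero_nth zero_neq_one)
  ultimately have 2: "fps_deriv rho_inv * (wt^4+3*wt^2+3) = - (rho_inv * (2*wt^3+3*wt) * p)"
    by (simp add: add_eq_0_iff2)
  have "fps_deriv (eta_even * rho_inv) * ((wt^2+1)*(wt^4+3)*(wt^4+3*wt^2+3)) =
      (fps_deriv eta_even * (wt^4+3) * (wt^2+1)) * (rho_inv * (wt^4+3*wt^2+3))
      + (fps_deriv rho_inv * (wt^4+3*wt^2+3)) * (eta_even * (wt^2+1) * (wt^4+3))"
    by (simp add: algebra_simps)
  also have "\<dots> = - (eta_even*rho_inv) * p * wt *
      (2*(wt^2+3)*(wt^2-1)*(wt^4+3*wt^2+3) + (2*wt^2+3)*(wt^2+1)*(wt^4+3))"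
    unfolding 1 2 by algebra
  finally show ?thesis unfolding chi_even_def .
qed

lemma lift_z_nth: "lift_z f $ n = [:f $ n:]" by (simp add: lift_z_def)

lemma lift_z_add: "lift_z (f + g) = lift_z f + lift_z g"
  by (simp add: fps_eq_iff lift_z_nth)
lemma lift_z_diff: "lift_z (f - g) = lift_z f - lift_z g"
  by (simp add: fps_eq_iff lift_z_nth)

lemma const_poly_sum: "[:sum f A:] = (\<Sum>i\<in>A. [:f i:])"
  by (rule poly_eqI) (simp add: coeff_sum coeff_pCons split: nat.split)

lemma lift_z_mult: "lift_z (f * g) = lift_z f * lift_z g"
  by (simp add: fps_eq_iff lift_z_nth fps_mult_nth const_poly_sum mult.commute)

lemma lift_z_1: "lift_z 1 = 1"
  by (simp add: fps_eq_iff lift_z_nth one_pCons)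
lemma lift_z_numeral: "lift_z (numeral n) = numeral n"
  by (simp add: fps_eq_iff lift_z_nth numeral_fps_const numeral_poly)
lemma lift_z_X: "lift_z fps_X = fps_X"
  by (simp add: fps_eq_iff lift_z_nth fps_X_def one_pCons)
lemma lift_z_power: "lift_z (f ^ n) = lift_z f ^ n"
  by (induction n) (auto simp: lift_z_mult lift_z_1)
lemma lift_z_deriv: "lift_z (fps_deriv f) = fps_deriv (lift_z f)"
  by (simp add: fps_eq_iff lift_z_nth of_nat_poly)

lemmas lift_z_hom = lift_z_add lift_z_diff lift_z_mult lift_z_1 lift_z_numeral
  lift_z_X lift_z_power

definition cosh_zJ :: "complex poly fps" where "cosh_zJ = lift_z fps_cosh oo (fps_z * lift_z J_fps)"
definition sinh_zJ :: "complex poly fps" where "sinh_zJ = lift_z fps_sinh oo (fps_z * lift_z J_fps)"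

lemma zJ_0: "(fps_z * lift_z J_fps) $ 0 = 0"
  by (simp add: lift_z_nth fps_z_def)

lemma cosh_sinh_deriv: "fps_deriv fps_cosh = fps_sinh" "fps_deriv fps_sinh = fps_cosh"
proof -
  have "fps_const (-1) * f = - f" for f :: "complex fps" by (simp add: fps_eq_iff)
  then show "fps_deriv fps_cosh = fps_sinh" "fps_deriv fps_sinh = fps_cosh"
    by (simp_all add: fps_cosh_def fps_sinh_def)
qed

lemma cosh_zJ_deriv: "fps_deriv cosh_zJ = sinh_zJ * (fps_z * (lift_z rho_inv * lift_z (fps_deriv wt)))"
  and sinh_zJ_deriv: "fps_deriv sinh_zJ = cosh_zJ * (fps_z * (lift_z rho_inv * lift_z (fps_deriv wt)))"
proof -
  have "fps_deriv (fps_z * lift_z J_fps) = fps_z * (lift_z rho_inv * lift_z (fps_deriv wt))"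
    by (simp add: fps_z_def lift_z_deriv[symmetric] J_deriv lift_z_mult)
  then show "fps_deriv cosh_zJ = sinh_zJ * (fps_z * (lift_z rho_inv * lift_z (fps_deriv wt)))"
    "fps_deriv sinh_zJ = cosh_zJ * (fps_z * (lift_z rho_inv * lift_z (fps_deriv wt)))"
    by (simp_all add: cosh_zJ_def sinh_zJ_def fps_compose_deriv[OF zJ_0] lift_z_deriv[symmetric] cosh_sinh_deriv)
qed

lemma chi_odd_deriv: "3 * fps_deriv chi_odd = - (fps_deriv chi_even * wt^3 + 3 * chi_even * wt^2 * fps_deriv wt)"
proof -
  have "fps_deriv (3 * chi_odd) = fps_deriv (- chi_even * wt^3)" by (simp only: chi_odd_eq)
  then show ?thesis by (simp add: eval_nat_numeral algebra_simps)
qed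

lemma eta_split: "eta = eta_even + wt * eta_even" by (simp add: eta_param algebra_simps)

text \<open>
  The eight identities behind the differential system, where \<open>rho_inv * p\<close> is \<open>J'\<close>. The first four
  are the terms without \<open>z\<close>, the last four those with the factor \<open>z\<close>; odd positions belong to the
  first equation of the system and even positions to the second.
\<close>

lemma series_system:
  defines "t \<equiv> fps_X :: complex fps" and "p \<equiv> fps_deriv wt"
  shows "(1 - t^2) * (p*eta_even + wt*fps_deriv eta_even) - t*fps_deriv eta_even = eta_even + t*(wt*eta_even)"
    and "t * (p*eta_even + wt*fps_deriv eta_even) + (1-3*t^2)*fps_deriv eta_even = 3*t*eta_even"
    and "(1 - t^2) * fps_deriv chi_even - t*fps_deriv chi_odd = chi_odd + t*chi_even"
    and "t * fps_deriv chi_even + (1-3*t^2)*fps_deriv chi_odd = 3*t*chi_odd"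
    and "(1-t^2) * (rho_inv*p) * chi_even - t * (rho_inv*p) * chi_odd = eta_even"
    and "t * (rho_inv*p) * chi_even + (1-3*t^2) * (rho_inv*p) * chi_odd = wt*eta_even"
    and "(1-t^2) * (rho_inv*p) * (wt * eta_even) - t * (rho_inv*p) * eta_even = chi_odd"
    and "t * (rho_inv*p) * (wt * eta_even) + (1-3*t^2) * (rho_inv*p) * eta_even = chi_even"
proof -
  note I = param_identities[OF wt_eq wt_deriv wt_units(2), folded t_def p_def]
  show "(1 - t^2) * (p*eta_even + wt*fps_deriv eta_even) - t*fps_deriv eta_even = eta_even + t*(wt*eta_even)"
    "t * (p*eta_even + wt*fps_deriv eta_even) + (1-3*t^2)*fps_deriv eta_even = 3*t*eta_even"
    unfolding t_def p_def by (rule eta_parts_system[OF wt_eq wt_deriv wt_units(2) eta_even_eq eta_even_deriv])+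
  show "(1 - t^2) * fps_deriv chi_even - t*fps_deriv chi_odd = chi_odd + t*chi_even"
    "t * fps_deriv chi_even + (1-3*t^2)*fps_deriv chi_odd = 3*t*chi_odd"
    unfolding t_def
    by (rule chi_parts_system[OF wt_eq wt_deriv wt_units(1,2) chi_even_deriv chi_odd_eq chi_odd_deriv])+
  have "3 * ((1-t^2) * (rho_inv*p) * chi_even - t * (rho_inv*p) * chi_odd - eta_even) = 0"
    using I(3) rho_inv_eq chi_odd_eq unfolding chi_even_def by algebra
  then show "(1-t^2) * (rho_inv*p) * chi_even - t * (rho_inv*p) * chi_odd = eta_even" by (simp del: right_diff_distrib_numeral)
  have "3 * (t * (rho_inv*p) * chi_even + (1-3*t^2) * (rho_inv*p) * chi_odd - wt*eta_even) = 0"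
    using I(4) rho_inv_eq chi_odd_eq unfolding chi_even_def by algebra
  then show "t * (rho_inv*p) * chi_even + (1-3*t^2) * (rho_inv*p) * chi_odd = wt*eta_even" by (simp del: right_diff_distrib_numeral)
  have "3 * ((1-t^2) * (rho_inv*p) * (wt * eta_even) - t * (rho_inv*p) * eta_even - chi_odd) = 0"
    using I(2) chi_odd_eq unfolding chi_even_def by algebra
  then show "(1-t^2) * (rho_inv*p) * (wt * eta_even) - t * (rho_inv*p) * eta_even = chi_odd" by (simp del: right_diff_distrib_numeral)
  show "t * (rho_inv*p) * (wt * eta_even) + (1-3*t^2) * (rho_inv*p) * eta_even = chi_even"
    using I(1) unfolding chi_even_def by algebra
qed

text \<open>
  The even and odd parts in \<open>t\<close> of the right-hand side of the theorem: \<open>J\<close> is odd, hence so is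
  \<open>sinh (z J)\<close>, while \<open>cosh (z J)\<close> is even.
\<close>

definition Ups_even where "Ups_even = lift_z eta_even * cosh_zJ + lift_z chi_odd * sinh_zJ"
definition Ups_odd where "Ups_odd = lift_z (wt * eta_even) * cosh_zJ + lift_z chi_even * sinh_zJ"

text \<open>
  The substitution as pure algebra: \<open>C\<close> and \<open>S\<close> are \<open>cosh (z J)\<close> and \<open>sinh (z J)\<close>, whose derivatives
  are \<open>S z j\<close> and \<open>C z j\<close> for \<open>j = J'\<close>; the names ending in 1 stand for derivatives.
\<close>

lemma hyperbolic_system:
  fixes t z j h h1 k k1 x x1 y y1 C S :: "'a::comm_ring_1"
  assumes 1: "(1 - t^2) * k1 - t*h1 = h + t*k" and 2: "t * k1 + (1-3*t^2)*h1 = 3*t*h"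
    and 3: "(1 - t^2) * y1 - t*x1 = x + t*y" and 4: "t * y1 + (1-3*t^2)*x1 = 3*t*x"
    and 5: "(1-t^2) * j * y - t * j * x = h" and 6: "t * j * y + (1-3*t^2) * j * x = k"
    and 7: "(1-t^2) * j * k - t * j * h = x" and 8: "t * j * k + (1-3*t^2) * j * h = y"
  defines "e \<equiv> h * C + x * S" and "o' \<equiv> k * C + y * S"
    and "e1 \<equiv> h1 * C + h * (S * (z * j)) + x1 * S + x * (C * (z * j))"
    and "o1 \<equiv> k1 * C + k * (S * (z * j)) + y1 * S + y * (C * (z * j))"
  shows "(1 - t^2) * o1 - t * e1 = (z + 1) * e + t * o'"
    and "t * o1 + (1 - 3 * t^2) * e1 = z * o' + 3 * t * e"
proof -
  have "(1 - t^2) * o1 - t * e1 = ((1 - t^2) * k1 - t*h1) * C + ((1 - t^2) * y1 - t*x1) * S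
      + z * (((1-t^2) * j * y - t * j * x) * C + ((1-t^2) * j * k - t * j * h) * S)"
    unfolding o1_def e1_def by (simp add: algebra_simps)
  also have "\<dots> = (z + 1) * e + t * o'"
    unfolding 1 3 5 7 e_def o'_def by (simp add: algebra_simps)
  finally show "(1 - t^2) * o1 - t * e1 = (z + 1) * e + t * o'" .
  have "t * o1 + (1 - 3 * t^2) * e1 = (t * k1 + (1-3*t^2)*h1) * C + (t * y1 + (1-3*t^2)*x1) * S
      + z * ((t * j * y + (1-3*t^2) * j * x) * C + (t * j * k + (1-3*t^2) * j * h) * S)"
    unfolding o1_def e1_def by (simp add: algebra_simps)
  also have "\<dots> = z * o' + 3 * t * e"
    unfolding 2 4 6 8 e_def o'_def by (simp add: algebra_simps)
  finally show "t * o1 + (1 - 3 * t^2) * e1 = z * o' + 3 * t * e" .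
qed

lemma Ups_system:
  shows "(1 - fps_X^2) * fps_deriv Ups_odd - fps_X * fps_deriv Ups_even = (fps_z + 1) * Ups_even + fps_X * Ups_odd"
    and "fps_X * fps_deriv Ups_odd + (1 - 3 * fps_X^2) * fps_deriv Ups_even = fps_z * Ups_odd + 3 * fps_X * Ups_even"
proof -
  define j where "j = lift_z (rho_inv * fps_deriv wt)"
  have d: "fps_deriv cosh_zJ = sinh_zJ * (fps_z * j)" "fps_deriv sinh_zJ = cosh_zJ * (fps_z * j)"
    by (simp_all add: cosh_zJ_deriv sinh_zJ_deriv j_def lift_z_mult)
  have dUe: "fps_deriv Ups_even = lift_z (fps_deriv eta_even) * cosh_zJ + lift_z eta_even * (sinh_zJ * (fps_z * j))
      + lift_z (fps_deriv chi_odd) * sinh_zJ + lift_z chi_odd * (cosh_zJ * (fps_z * j))"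
    by (simp add: Ups_even_def lift_z_deriv d algebra_simps)
  have dUo: "fps_deriv Ups_odd = lift_z (fps_deriv (wt * eta_even)) * cosh_zJ + lift_z (wt * eta_even) * (sinh_zJ * (fps_z * j))
      + lift_z (fps_deriv chi_even) * sinh_zJ + lift_z chi_even * (cosh_zJ * (fps_z * j))"
    by (simp only: Ups_odd_def lift_z_deriv fps_deriv_add) (simp add: d algebra_simps)
  note lifted = series_system[THEN arg_cong[where f = lift_z]]
  have "(1 - fps_X^2) * lift_z (fps_deriv (wt * eta_even)) - fps_X * lift_z (fps_deriv eta_even) = lift_z eta_even + fps_X * lift_z (wt * eta_even)"
    "fps_X * lift_z (fps_deriv (wt * eta_even)) + (1-3*fps_X^2) * lift_z (fps_deriv eta_even) = 3*fps_X*lift_z eta_even"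
    "(1 - fps_X^2) * lift_z (fps_deriv chi_even) - fps_X * lift_z (fps_deriv chi_odd) = lift_z chi_odd + fps_X * lift_z chi_even"
    "fps_X * lift_z (fps_deriv chi_even) + (1-3*fps_X^2) * lift_z (fps_deriv chi_odd) = 3*fps_X*lift_z chi_odd"
    "(1-fps_X^2) * j * lift_z chi_even - fps_X * j * lift_z chi_odd = lift_z eta_even"
    "fps_X * j * lift_z chi_even + (1-3*fps_X^2) * j * lift_z chi_odd = lift_z (wt * eta_even)"
    "(1-fps_X^2) * j * lift_z (wt * eta_even) - fps_X * j * lift_z eta_even = lift_z chi_odd"
    "fps_X * j * lift_z (wt * eta_even) + (1-3*fps_X^2) * j * lift_z eta_even = lift_z chi_even"
    using lifted unfolding j_def lift_z_hom fps_deriv_mult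
    by (simp_all only: mult.commute add.commute mult.left_commute)
  note sys = hyperbolic_system[OF this, where z = fps_z and C = cosh_zJ and S = sinh_zJ,
      folded Ups_even_def Ups_odd_def dUe dUo]
  show "(1 - fps_X^2) * fps_deriv Ups_odd - fps_X * fps_deriv Ups_even = (fps_z + 1) * Ups_even + fps_X * Ups_odd"
    by (rule sys)
  show "fps_X * fps_deriv Ups_odd + (1 - 3 * fps_X^2) * fps_deriv Ups_even = fps_z * Ups_odd + 3 * fps_X * Ups_even"
    by (rule sys)
qed

lemma Ups_0: "Ups_even $ 0 = 1" "Ups_odd $ 0 = 0"
proof -
  have "cosh_zJ $ 0 = 1" "sinh_zJ $ 0 = 0"
    by (simp_all add: cosh_zJ_def sinh_zJ_def fps_compose_nth lift_z_nth fps_cosh_def fps_sinh_def one_pCons)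
  then show "Ups_even $ 0 = 1" "Ups_odd $ 0 = 0"
    by (simp_all add: Ups_even_def Ups_odd_def lift_z_nth one_pCons chi_even_def chi_odd_def fps_power_zeroth)
qed

text \<open>
  The system in coefficients. Because \<open>t o + t\<^sup>2 o' = t (t o)'\<close> and \<open>3 t e + 3 t\<^sup>2 e' = 3 t (t e)'\<close>, these
  terms contribute \<open>n\<close> times the coefficient of \<open>t o\<close> or \<open>3 t e\<close> at \<open>t\<^sup>n\<close>. Written with \<open>t o\<close> and
  \<open>t e\<close> instead of an index \<open>n - 1\<close>, the recurrences cover \<open>n = 0\<close>.
\<close>

lemma Ups_odd_rec: "of_nat (Suc n) * Ups_odd $ Suc n = ([:0,1:] + 1 + of_nat n) * Ups_even $ n + of_nat n * (fps_X * Ups_odd) $ n"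
  and Ups_even_rec: "of_nat (Suc n) * Ups_even $ Suc n = ([:0,1:] - of_nat n) * Ups_odd $ n + 3 * of_nat n * (fps_X * Ups_even) $ n"
proof -
  have X: "(fps_X * fps_deriv f) $ n = of_nat n * f $ n" for f :: "complex poly fps"
    by (cases n) simp_all
  have N: "(3 * f) $ n = 3 * f $ n" for f :: "complex poly fps"
    by (simp add: numeral_fps_const)
  have 1: "fps_deriv Ups_odd = fps_z * Ups_even + Ups_even + fps_X * fps_deriv Ups_even + fps_X * fps_deriv (fps_X * Ups_odd)"
    using Ups_system(1) by (simp add: algebra_simps power2_eq_square)
  have 2: "fps_deriv Ups_even = fps_z * Ups_odd - fps_X * fps_deriv Ups_odd + 3 * (fps_X * fps_deriv (fps_X * Ups_even))"
    using Ups_system(2) by (simp add: algebra_simps power2_eq_square)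
  show "of_nat (Suc n) * Ups_odd $ Suc n = ([:0,1:] + 1 + of_nat n) * Ups_even $ n + of_nat n * (fps_X * Ups_odd) $ n"
    using arg_cong[OF 1, of "\<lambda>f. f $ n"] unfolding fps_add_nth X
    by (simp add: fps_z_def ring_distribs)
  show "of_nat (Suc n) * Ups_even $ Suc n = ([:0,1:] - of_nat n) * Ups_odd $ n + 3 * of_nat n * (fps_X * Ups_even) $ n"
    using arg_cong[OF 2, of "\<lambda>f. f $ n"] unfolding fps_add_nth fps_sub_nth N X
    by (simp add: fps_z_def ring_distribs mult.assoc)
qed

lemma c_coeff_eq: "c_coeff j = (if even j then - (of_nat j + 1) else of_nat j)"
  by (simp add: c_coeff_def power_int_diff)

lemma a_coeff_eq: "a_coeff j = - (if even j then 1 else 3) * (of_nat j)^2"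
  by (simp add: a_coeff_def)

lemma q_poly_rec:
  "q_poly (Suc (Suc k)) =
     (if even k then ([:0, 1:] - of_nat (Suc k)) * q_poly (Suc k) + 3 * of_nat (Suc k)^2 * q_poly k
      else ([:0, 1:] + 1 + of_nat (Suc k)) * q_poly (Suc k) + of_nat (Suc k)^2 * q_poly k)"
proof -
  have "q_poly (Suc (Suc k)) = ([:0, 1:] - [:c_coeff (Suc k):]) * q_poly (Suc k) - [:a_coeff (Suc k):] * q_poly k"
    by simp
  moreover have "[:c_coeff (Suc k):] = (if even k then of_nat (Suc k) else - (of_nat (Suc k) + 1))"
    by (simp only: c_coeff_eq of_nat_poly one_pCons even_Suc) simp
  moreover have "[:a_coeff (Suc k):] = (if even k then - (3 * of_nat (Suc k)^2) else - (of_nat (Suc k)^2))"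
    by (simp only: a_coeff_eq of_nat_poly numeral_poly even_Suc) (simp add: power2_eq_square)
  ultimately show ?thesis by simp
qed

text \<open>
  The two recurrences give the recurrence of the polynomials \<open>q\<^sub>k\<close> alternately, and keep the
  coefficients of the wrong parity at zero.
\<close>

lemma Ups_coeffs:
  "fact n * Ups_even $ n = (if even n then q_poly n else 0) \<and> fact n * Ups_odd $ n = (if even n then 0 else q_poly n)"
proof (induction n rule: q_poly.induct)
  case 1
  then show ?case by (simp add: Ups_0)
next
  case 2
  show ?case using Ups_odd_rec[of 0] Ups_even_rec[of 0] by (simp add: Ups_0 c_coeff_eq one_pCons)
next
  case (3 k)
  have f: "fact (Suc (Suc k)) = (fact (Suc k) :: complex poly) * of_nat (Suc (Suc k))"
     "fact (Suc k) = (fact k :: complex poly) * of_nat (Suc k)" by (simp_all only: fact_Suc mult.commute of_nat_mult)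
  have "fact (Suc (Suc k)) * Ups_odd $ Suc (Suc k) = fact (Suc k) * (of_nat (Suc (Suc k)) * Ups_odd $ Suc (Suc k))"
    by (simp only: f(1) mult.assoc)
  also have "\<dots> = ([:0,1:] + 1 + of_nat (Suc k)) * (fact (Suc k) * Ups_even $ Suc k)
     + of_nat (Suc k)^2 * (fact k * Ups_odd $ k)"
    unfolding Ups_odd_rec unfolding f(2) by (simp add: algebra_simps power2_eq_square)
  finally have o: "fact (Suc (Suc k)) * Ups_odd $ Suc (Suc k) = \<dots>" .
  have "fact (Suc (Suc k)) * Ups_even $ Suc (Suc k) = fact (Suc k) * (of_nat (Suc (Suc k)) * Ups_even $ Suc (Suc k))"
    by (simp only: f(1) mult.assoc)
  also have "\<dots> = ([:0,1:] - of_nat (Suc k)) * (fact (Suc k) * Ups_odd $ Suc k)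
     + 3 * of_nat (Suc k)^2 * (fact k * Ups_even $ k)"
    unfolding Ups_even_rec unfolding f(2) by (simp add: algebra_simps power2_eq_square)
  finally have e: "fact (Suc (Suc k)) * Ups_even $ Suc (Suc k) = \<dots>" .
  show ?case
  proof (cases "even k")
    case True
    have "fact (Suc k) * Ups_even $ Suc k = 0" "fact (Suc k) * Ups_odd $ Suc k = q_poly (Suc k)"
       "fact k * Ups_even $ k = q_poly k" "fact k * Ups_odd $ k = 0"
      using "3.IH" True by (simp_all only: even_Suc if_True if_False simp_thms)
    with True show ?thesis unfolding o e q_poly_rec by (simp only: even_Suc if_True if_False simp_thms mult_zero_right add_0_left add_0_right)
  next
    case False
    have "fact (Suc k) * Ups_even $ Suc k = q_poly (Suc k)" "fact (Suc k) * Ups_odd $ Suc k = 0"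
       "fact k * Ups_even $ k = 0" "fact k * Ups_odd $ k = q_poly k"
      using "3.IH" False by (simp_all only: even_Suc if_True if_False simp_thms)
    with False show ?thesis unfolding o e q_poly_rec by (simp only: even_Suc if_True if_False simp_thms mult_zero_right add_0_left add_0_right)
  qed
qed

lemma Upsilon_eq: "Upsilon = lift_z eta * cosh_zJ + lift_z chi * sinh_zJ"
proof -
  have "lift_z eta * cosh_zJ + lift_z chi * sinh_zJ = Ups_even + Ups_odd"
    by (simp add: Ups_even_def Ups_odd_def chi_split eta_split lift_z_add algebra_simps)
  also have "\<dots> = Upsilon"
  proof (rule fps_ext)
    fix n
    have "fact n * (Ups_even + Ups_odd) $ n = q_poly n"
      unfolding fps_add_nth distrib_left using Ups_coeffs[of n] by (cases "even n") auto
    moreover have "(fact n :: complex poly) = [:fact n:]"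
      by (metis of_nat_fact of_nat_poly)
    ultimately have "smult (fact n) ((Ups_even + Ups_odd) $ n) = q_poly n" by simp
    then show "(Ups_even + Ups_odd) $ n = Upsilon $ n"
      by (simp add: Upsilon_def flip: \<open>smult (fact n) ((Ups_even + Ups_odd) $ n) = q_poly n\<close>)
  qed
  finally show ?thesis ..
qed

theorem theorem6:
  shows "irreducible curve_poly
    \<and> (\<exists>!f. is_branch f)
    \<and> has_genus (function_field (fps_to_fls eta)) 0
    \<and> {(t :: complex, y :: complex). curve t y = 0} =
        (\<lambda>w. (1/3 * ((w^2 + 3) * w / (w^2 + 1)),
              3 * ((w + 1) * (w^2 + 1) / (w^4 + 3)))) ` {w. w^2 + 1 \<noteq> 0 \<and> w^4 + 3 \<noteq> 0}
    \<and> map (\<lambda>n. fact n * eta $ n) [0..<8] = [1, 1, 2, 10, 24, 280, 400, 12880]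
    \<and> map (\<lambda>n. fact n * chi $ n) [0..<7] = [1, 0, 1, -2, 1, -100, -575]
    \<and> map (\<lambda>n. fact n * J_fps $ n) [0..<10] = [0, 1, 0, 3, 0, 45, 0, 1215, 0, 8505]
    \<and> Upsilon = lift_z eta * (lift_z fps_cosh oo (fps_z * lift_z J_fps))
              + lift_z chi * (lift_z fps_sinh oo (fps_z * lift_z J_fps))"
  using irreducible_curve_poly ex1_branch genus_0 curve_points eta_coeffs chi_coeffs J_coeffs
    Upsilon_eq[unfolded cosh_zJ_def sinh_zJ_def]
  by blast

end
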